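(* Let $d\ge1$. There exist constants $c(d),C(d)>0$ depending only on $d$ such that, for all real numbers $n_1,\dots,n_d\ge1$, the set $$\Delta_{\bm{n}}=\left\{\bm{\xi}\in\mathbb{R}_+^d:\ \sum_{j=1}^d\frac{\xi_j}{n_j}\le1\right\}$$ satisfies $$c(d)\prod_{j=1}^d\log(n_j+1)\le\mathcal{L}(\Delta_{\bm{n}})\le C(d)\prod_{j=1}^d\log(n_j+1).$$
   Context: $\mathbb{R}_+^d$ is the set of vectors in $\mathbb{R}^d$ with nonnegative coordinates. For a bounded set $W\subset\mathbb{R}^d$ the Lebesgue constant is $$\mathcal{L}(W)=\frac{1}{(2\pi)^d}\int_{\mathbb{T}^d}\bigg|\sum_{\bm{k}\in W\cap\mathbb{Z}^d}e^{i(\bm{k},\bm{x})}\bigg|\,d\bm{x},\qquad \mathbb{T}^d\simeq(-\pi,\pi]^d,$$ where $(\bm{k},\bm{x})=k_1x_1+\dots+k_dx_d$. *)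

theory Defs
  imports "HOL-Analysis.Analysis"
begin

definition integer_lattice :: "(real ^ 'd::finite) set" where
  "integer_lattice = {k. \<forall>j. k $ j \<in> \<int>}"

definition torus :: "(real ^ 'd::finite) set" where
  "torus = {x. \<forall>j. - pi < x $ j \<and> x $ j \<le> pi}"

(* Meaningful for bounded W only: for infinite W \<inter> integer_lattice the library sum is 0. *)
definition lebesgue_constant :: "(real ^ 'd::finite) set \<Rightarrow> real" where
  "lebesgue_constant W =
     1 / (2 * pi) ^ CARD('d) *
     (LINT x:torus|lborel. cmod (\<Sum>k\<in>W \<inter> integer_lattice. exp (\<i> * complex_of_real (k \<bullet> x))))"

definition simplex_region :: "real ^ 'd::finite \<Rightarrow> (real ^ 'd) set" where
  "simplex_region n = {\<xi>. (\<forall>j. 0 \<le> \<xi> $ j) \<and> (\<Sum>j\<in>UNIV. \<xi> $ j / n $ j) \<le> 1}"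

end

theory Submission
  imports Defs
begin

text \<open>
  Let \<open>D(x) = \<Sum>k. cis (k \<bullet> x)\<close>, summed over the lattice points of the simplex.

  Lower bound.  A sawtooth multiplied by a character gives a function \<open>\<psi>\<close> on the circle with
  \<open>\<bar>\<psi>\<bar> \<le> 1\<close> and \<open>\<integral> cis (k t) \<psi>(t) dt = 2 / (k + 1)\<close> for every natural \<open>k\<close>; this is the duality
  behind Hardy's inequality.  Testing \<open>D\<close> against \<open>\<Prod>j. \<psi>(x\<^sub>j)\<close> bounds \<open>\<integral>\<bar>D\<bar>\<close> from below by
  \<open>\<Sum>k. \<Prod>j. 2 / (k\<^sub>j + 1)\<close>.  The simplex contains the box \<open>k\<^sub>j \<le> n\<^sub>j / m\<close>, where \<open>m\<close> is the
  dimension, and over the box this sum is a product of harmonic numbers up to constants.  See \<open>trig_L1_ge_hardy_sum\<close> and \<open>hardy_sum_lattice_simplex_ge\<close>.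

  Upper bound.  Induction on the dimension, splitting off the coordinate \<open>d\<close> with the largest \<open>n\<^sub>d\<close>.
  Let \<open>N\<close> be about \<open>n\<^sub>d\<close> and \<open>x\<close> the variable of that coordinate.  For \<open>\<bar>x\<bar> \<le> 1/N\<close> each of the at
  most \<open>N + 1\<close> slices \<open>k\<^sub>d = l\<close> is a lower-dimensional simplex, and the slices together cost a
  factor \<open>O(1)\<close> after integration over the short interval.  For larger \<open>x\<close> the columns are summed as
  geometric series, which gives a factor of order \<open>1/\<bar>x\<bar>\<close> and leaves sums over the lower-dimensional
  simplex with coefficients \<open>cis (x \<lfloor>\<lambda>(k)\<rfloor>)\<close>, where \<open>\<lambda>\<close> is the affine column height.

  If the floor were absent, the coefficient would be a character, that is, a translation, which does
  not change the \<open>L\<^sup>1\<close> norm.  The essential estimate \<open>trig_L1_floor_modulation_le\<close> says that the floor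
  costs only a factor \<open>1 + O(\<bar>x\<bar> log N)\<close>.  Its gain of \<open>\<bar>x\<bar>\<close> cancels the \<open>1/\<bar>x\<bar>\<close>, so that
  integration over \<open>x\<close> gives one factor \<open>log N\<close> and not its square.

  To prove it, \<open>\<lambda>\<close> is replaced by an affine form with rational coefficients, of common denominator \<open>q\<close>
  polynomial in \<open>N\<close>, that has the same floors at the points in question
  (\<open>rational_affine_same_floor\<close>).  Then \<open>cis (x \<lfloor>p / q\<rfloor>)\<close> is a combination of characters in \<open>p\<close>, by the
  discrete Fourier transform modulo \<open>q\<close>; its coefficients are geometric sums and have total size at
  most \<open>1 + \<bar>x\<bar> (1 + log q)\<close>.  Such a rational form exists because a solvable system of strict linear
  inequalities with integer coefficients bounded by \<open>N\<close> has a solution whose slack is at least a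
  negative power of \<open>N\<close>, by Fourier--Motzkin elimination (\<open>fourier_motzkin_gap\<close>).  The maximality of
  \<open>n\<^sub>d\<close> enters here: all coordinates of the lattice points are bounded by \<open>N\<close>, so \<open>log q = O(log N)\<close>.
\<close>

section \<open>Affine forms with rational coefficients and prescribed floors\<close>

lemma real_between_finite_sets:
  fixes L U :: "real set"
  assumes "finite L" "finite U" and le: "\<And>l u. l \<in> L \<Longrightarrow> u \<in> U \<Longrightarrow> l \<le> u"
  shows "\<exists>z. (\<forall>l\<in>L. l \<le> z) \<and> (\<forall>u\<in>U. z \<le> u)"
proof (cases "L = {}")
  case True
  then show ?thesis
    using assms(2) by (cases "U = {}") (auto intro!: exI[of _ "Min U"])
next
  case False
  then show ?thesis
    using assms by (intro exI[of _ "Max L"]) auto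
qed

text \<open>
  A triple \<open>(r, c, s)\<close> stands for the inequality \<open>r \<bullet> z \<le> c\<close>, strict if \<open>s > 0\<close>.  The weight \<open>s\<close>
  counts the strict inequalities that have been added up, with multiplicity, during elimination, so
  that it also says which multiple of the slack an inequality has to carry.  Without unknowns a
  strict inequality reads \<open>0 < c\<close> with an integer \<open>c\<close>, hence \<open>1 \<le> c\<close>: this is where a quantitative
  slack comes from.  Eliminating one unknown replaces the bound \<open>M\<close> by \<open>2 M\<^sup>2\<close>, which
  is what makes the exponent \<open>2 ^ card J\<close> double.
\<close>

lemma fourier_motzkin_gap:
  fixes z :: "'i \<Rightarrow> real" and Cs :: "(('i \<Rightarrow> int) \<times> int \<times> int) set" and M :: nat
  assumes "finite J" "finite Cs" "1 \<le> M"
    and "\<And>r c s. (r, c, s) \<in> Cs \<Longrightarrow> 0 \<le> s \<and> s \<le> int M \<and> (\<forall>j\<in>J. \<bar>r j\<bar> \<le> int M)"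
    and "\<And>r c s. (r, c, s) \<in> Cs \<Longrightarrow>
           (\<Sum>j\<in>J. of_int (r j) * z j) \<le> of_int c \<and> (0 < s \<longrightarrow> (\<Sum>j\<in>J. of_int (r j) * z j) < of_int c)"
  shows "\<exists>w. \<forall>(r, c, s)\<in>Cs. (\<Sum>j\<in>J. of_int (r j) * w j) + of_int s / real ((2 * M) ^ 2 ^ card J) \<le> of_int c"
  using assms
proof (induction J arbitrary: M Cs rule: finite_induct)
  case empty
  have "of_int s / (2 * real M) \<le> of_int c" if "(r, c, s) \<in> Cs" for r c s
  proof (cases "0 < s")
    case True
    have "of_int s / (2 * real M) \<le> 1"
      using empty.prems(2) empty.prems(3)[OF that] by (simp add: divide_simps)
    moreover have "0 < c"
      using empty.prems(4)[OF that] True by simp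
    ultimately show ?thesis by linarith
  next
    case False
    then have "s = 0" using empty.prems(3)[OF that] by simp
    then show ?thesis using empty.prems(4)[OF that] by simp
  qed
  then show ?case by auto
next
  case (insert i J)
  define e where "e = 1 / real ((2 * M) ^ 2 ^ card (insert i J))"
  (* P and Q bound the eliminated unknown from above and from below; every pair from P and Q is
     combined positively so that the unknown cancels. *)
  define P where "P = {x \<in> Cs. 0 < fst x i}"
  define Q where "Q = {x \<in> Cs. fst x i < 0}"
  define Z where "Z = {x \<in> Cs. fst x i = 0}"
  define comb where "comb = (\<lambda>((r, c, s), (r', c', s')).
    ((\<lambda>j. - r' i * r j + r i * r' j), - r' i * c + r i * c', - r' i * s + r i * (s'::int)) :: ('i \<Rightarrow> int) \<times> int \<times> int)"
  let ?C = "Z \<union> comb ` (P \<times> Q)"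
  have prems: "0 \<le> s" "s \<le> int M" "\<bar>r i\<bar> \<le> int M" "\<And>j. j \<in> J \<Longrightarrow> \<bar>r j\<bar> \<le> int M"
    if "(r, c, s) \<in> Cs" for r c s
    using insert.prems(3)[OF that] by auto
  have MM: "int M \<le> 2 * int M * int M"
    using insert.prems(2) by (simp add: mult_le_cancel_right1)
  have fin: "finite ?C"
    using insert.prems(1) by (auto simp: P_def Q_def Z_def)
  have e_eq: "e = 1 / real ((2 * (2 * M * M)) ^ 2 ^ card J)"
  proof -
    have sq: "2 * (2 * M * M) = (2 * M) ^ 2" by (simp add: power2_eq_square)
    have "(2 * (2 * M * M)) ^ 2 ^ card J = (2 * M) ^ 2 ^ card (insert i J)"
      unfolding sq power_mult[symmetric] using insert.hyps by simp
    then show ?thesis by (simp add: e_def)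
  qed
  have prod2: "\<bar>- x * y + u * v\<bar> \<le> 2 * int M * int M"
    if "\<bar>x\<bar> \<le> int M" "\<bar>y\<bar> \<le> int M" "\<bar>u\<bar> \<le> int M" "\<bar>v\<bar> \<le> int M" for x y u v
  proof -
    have "\<bar>x * y\<bar> \<le> int M * int M" "\<bar>u * v\<bar> \<le> int M * int M"
      using that by (auto simp: abs_mult intro!: mult_mono)
    then show ?thesis by simp
  qed
  have bnd: "0 \<le> s \<and> s \<le> int (2 * M * M) \<and> (\<forall>j\<in>J. \<bar>r j\<bar> \<le> int (2 * M * M))"
    if "(r, c, s) \<in> ?C" for r c s
    using that
  proof
    assume "(r, c, s) \<in> Z"
    then show ?thesis using prems[of r c s] MM by (force simp: Z_def)
  next
    assume "(r, c, s) \<in> comb ` (P \<times> Q)"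
    then obtain r1 c1 s1 r2 c2 s2 where *: "(r1, c1, s1) \<in> Cs" "0 < r1 i" "(r2, c2, s2) \<in> Cs" "r2 i < 0"
      "r = (\<lambda>j. - r2 i * r1 j + r1 i * r2 j)" "s = - r2 i * s1 + r1 i * s2"
      by (auto simp: comb_def P_def Q_def)
    have "0 \<le> - r2 i * s1" "0 \<le> r1 i * s2"
      using * prems(1)[OF *(1)] prems(1)[OF *(3)] by (auto intro!: mult_nonneg_nonneg simp: mult_le_0_iff)
    then have "0 \<le> s" unfolding *(6) by linarith
    moreover have "s \<le> 2 * int M * int M"
      using prod2[of "r2 i" s1 "r1 i" s2] prems[OF *(1)] prems[OF *(3)] * by simp
    ultimately show ?thesis
      using prod2 prems[OF *(1)] prems[OF *(3)] * by auto
  qed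
  have feas: "(\<Sum>j\<in>J. of_int (r j) * z j) \<le> of_int c \<and> (0 < s \<longrightarrow> (\<Sum>j\<in>J. of_int (r j) * z j) < of_int c)"
    if "(r, c, s) \<in> ?C" for r c s
    using that
  proof
    assume "(r, c, s) \<in> Z"
    then show ?thesis using insert.prems(4)[of r c s] insert.hyps by (auto simp: Z_def)
  next
    assume "(r, c, s) \<in> comb ` (P \<times> Q)"
    then obtain r1 c1 s1 r2 c2 s2 where *: "(r1, c1, s1) \<in> Cs" "0 < r1 i" "(r2, c2, s2) \<in> Cs" "r2 i < 0"
      "r = (\<lambda>j. - r2 i * r1 j + r1 i * r2 j)" "s = - r2 i * s1 + r1 i * s2" "c = - r2 i * c1 + r1 i * c2"
      by (auto simp: comb_def P_def Q_def)
    define A where "A = of_int c1 - (\<Sum>j\<in>insert i J. of_int (r1 j) * z j)"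
    define B where "B = of_int c2 - (\<Sum>j\<in>insert i J. of_int (r2 j) * z j)"
    have AB: "0 \<le> A" "0 \<le> B" "0 < s1 \<Longrightarrow> 0 < A" "0 < s2 \<Longrightarrow> 0 < B"
      using insert.prems(4)[OF *(1)] insert.prems(4)[OF *(3)] by (auto simp: A_def B_def)
    have eq: "of_int c - (\<Sum>j\<in>J. of_int (r j) * z j) = of_int (- r2 i) * A + of_int (r1 i) * B"
    proof -
      have "(\<Sum>j\<in>J. of_int (r j) * z j) =
          of_int (- r2 i) * (\<Sum>j\<in>J. of_int (r1 j) * z j) + of_int (r1 i) * (\<Sum>j\<in>J. of_int (r2 j) * z j)"
        unfolding *(5) sum_distrib_left sum.distrib[symmetric] by (rule sum.cong) (auto simp: algebra_simps)
      then show ?thesis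
        using insert.hyps unfolding A_def B_def *(7) by (simp add: algebra_simps)
    qed
    have 1: "0 \<le> of_int (- r2 i) * A" "0 \<le> of_int (r1 i) * B"
      using AB * by (auto intro!: mult_nonneg_nonneg mult_nonpos_nonneg)
    have "0 < of_int (- r2 i) * A + of_int (r1 i) * B" if "0 < s"
    proof -
      have "0 < s1 \<or> 0 < s2"
      proof (rule ccontr)
        assume "\<not> ?thesis"
        then have "s1 = 0" "s2 = 0" using prems(1)[OF *(1)] prems(1)[OF *(3)] by auto
        then show False using that * by simp
      qed
      then have "0 < of_int (- r2 i) * A \<or> 0 < of_int (r1 i) * B"
        using AB * by (auto simp: mult_neg_pos)
      then show ?thesis using 1 by linarith
    qed
    then show ?thesis using 1 eq by auto
  qed
  have M1: "1 \<le> 2 * M * M" using insert.prems(2) by simp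
  have "\<exists>w. \<forall>(r, c, s)\<in>?C. (\<Sum>j\<in>J. of_int (r j) * w j) +
      of_int s / real ((2 * (2 * M * M)) ^ 2 ^ card J) \<le> of_int c"
    by (rule insert.IH[OF fin M1]) (erule bnd, erule feas)
  then obtain w where w: "\<forall>(r, c, s)\<in>?C. (\<Sum>j\<in>J. of_int (r j) * w j) + of_int s * e \<le> of_int c"
    unfolding e_eq by (auto simp only: mult_1_right times_divide_eq_right)
  (* v is the bound that a constraint, together with its slack, puts on the eliminated unknown. *)
  define v where "v = (\<lambda>(r, c, s). (of_int c - of_int s * e - (\<Sum>j\<in>J. of_int (r j) * w j)) / of_int (r i :: int))"
  have "\<exists>t. (\<forall>l\<in>v ` Q. l \<le> t) \<and> (\<forall>u\<in>v ` P. t \<le> u)"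
  proof (rule real_between_finite_sets)
    fix l u assume "l \<in> v ` Q" "u \<in> v ` P"
    then obtain r1 c1 s1 r2 c2 s2 where *: "(r1, c1, s1) \<in> P" "(r2, c2, s2) \<in> Q"
      "u = v (r1, c1, s1)" "l = v (r2, c2, s2)"
      by auto
    then have pos: "0 < r1 i" "r2 i < 0" by (auto simp: P_def Q_def)
    have "comb ((r1, c1, s1), (r2, c2, s2)) \<in> ?C" using * by blast
    from bspec[OF w this]
    have "of_int (r1 i) * (of_int c2 - of_int s2 * e - (\<Sum>j\<in>J. of_int (r2 j) * w j))
        \<ge> of_int (r2 i) * (of_int c1 - of_int s1 * e - (\<Sum>j\<in>J. of_int (r1 j) * w j))"
      by (simp add: comb_def algebra_simps sum.distrib sum_distrib_left sum_subtractf)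
    moreover have "of_int c1 - of_int s1 * e - (\<Sum>j\<in>J. of_int (r1 j) * w j) = of_int (r1 i) * u"
      "of_int c2 - of_int s2 * e - (\<Sum>j\<in>J. of_int (r2 j) * w j) = of_int (r2 i) * l"
      using pos * by (simp_all add: v_def)
    ultimately have "real_of_int (r1 i * r2 i) * u \<le> real_of_int (r1 i * r2 i) * l"
      by (simp add: mult_ac)
    moreover have "real_of_int (r1 i * r2 i) < 0" using pos by (simp add: mult_pos_neg)
    ultimately show "l \<le> u" by (simp only: mult_le_cancel_left_neg)
  qed (use insert.prems(1) in \<open>auto simp: P_def Q_def\<close>)
  then obtain t where t: "\<And>x. x \<in> Q \<Longrightarrow> v x \<le> t" "\<And>x. x \<in> P \<Longrightarrow> t \<le> v x" by auto
  have "(\<Sum>j\<in>insert i J. of_int (r j) * (w(i := t)) j) + of_int s * e \<le> of_int c" if "(r, c, s) \<in> Cs" for r c s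
  proof -
    have eq: "(\<Sum>j\<in>insert i J. of_int (r j) * (w(i := t)) j) = of_int (r i) * t + (\<Sum>j\<in>J. of_int (r j) * w j)"
      using insert.hyps by (auto intro!: sum.cong)
    consider "r i = 0" | "0 < r i" | "r i < 0" by linarith
    then show ?thesis
    proof cases
      case 1
      then have "(r, c, s) \<in> ?C" using that by (auto simp: Z_def)
      from bspec[OF w this] show ?thesis using 1 unfolding eq by simp
    next
      case 2
      then have "t \<le> v (r, c, s)" using t that by (auto simp: P_def)
      then show ?thesis using 2 unfolding eq v_def by (simp add: field_simps)
    next
      case 3
      then have "v (r, c, s) \<le> t" using t that by (auto simp: Q_def)
      then show ?thesis using 3 unfolding eq v_def by (simp add: field_simps)
    qed
  qed
  then show ?case
    unfolding e_def by (intro exI[of _ "w(i := t)"]) auto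
qed

text \<open>
  The power of \<open>2 * N\<close> is the reciprocal of the slack for \<open>m + 1\<close> unknowns, namely \<open>m\<close> coefficients and
  a constant term; \<open>1 + m * N\<close> bounds the effect of rounding them all to multiples of \<open>1 / q\<close>,
  measured in units of \<open>1 / q\<close>.  The number is made odd so that the residues have a
  representation by the symmetric range from \<open>- h\<close> to \<open>h\<close>.
\<close>

definition floor_denom :: "nat \<Rightarrow> nat \<Rightarrow> nat" where
  "floor_denom m N = 2 * ((1 + m * N) * (2 * N) ^ 2 ^ Suc m) + 1"

lemma floor_denom_pos: "0 < floor_denom m N"
  unfolding floor_denom_def by (rule add_nonneg_pos) auto

text \<open>
  Prescribing the floors of an affine form at the points of \<open>S\<close> is a system of linear inequalities for
  its coefficients, with integer data bounded by \<open>N\<close>, and strict on one side only.  A solution with a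
  definite slack on the strict side survives rounding its coefficients up, since the points have
  nonnegative coordinates.
\<close>

lemma rational_affine_same_floor:
  fixes a :: "'i \<Rightarrow> real" and b :: real and S :: "('i \<Rightarrow> nat) set"
  assumes "finite I" "finite S" "1 \<le> N" and kN: "\<And>k j. k \<in> S \<Longrightarrow> j \<in> I \<Longrightarrow> k j \<le> N"
  defines "q \<equiv> int (floor_denom (card I) N)"
  shows "\<exists>(p :: 'i \<Rightarrow> int) p0. \<forall>k\<in>S.
     \<lfloor>b + (\<Sum>j\<in>I. a j * real (k j))\<rfloor> * q \<le> p0 + (\<Sum>j\<in>I. p j * int (k j)) \<and>
     p0 + (\<Sum>j\<in>I. p j * int (k j)) < (\<lfloor>b + (\<Sum>j\<in>I. a j * real (k j))\<rfloor> + 1) * q"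
proof -
  define m where "m k = \<lfloor>b + (\<Sum>j\<in>I. a j * real (k j))\<rfloor>" for k
  (* None indexes the constant term of the form, Some j the coefficient of coordinate j. *)
  define J where "J = insert None (Some ` I)"
  define z where "z = case_option b a"
  define lo where "lo k = (case_option (-1) (\<lambda>j. - int (k j)), - m k, 0 :: int)" for k :: "'i \<Rightarrow> nat"
  define up where "up k = (case_option 1 (\<lambda>j. int (k j)), m k + 1, 1 :: int)" for k :: "'i \<Rightarrow> nat"
  define e where "e = 1 / real ((2 * N) ^ 2 ^ Suc (card I))"
  have cJ: "card J = Suc (card I)" "finite J"
    using assms(1) by (auto simp: J_def card_insert_if card_image)
  have sumJ: "(\<Sum>j\<in>J. f j) = f None + (\<Sum>j\<in>I. f (Some j))" for f :: "'i option \<Rightarrow> real"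
    using assms(1) by (simp add: J_def sum.reindex o_def)
  have "\<exists>w. \<forall>(r, c, s)\<in>lo ` S \<union> up ` S. (\<Sum>j\<in>J. of_int (r j) * w j) + of_int s / real ((2 * N) ^ 2 ^ card J) \<le> of_int c"
  proof (rule fourier_motzkin_gap[where z = z])
    fix r c s assume "(r, c, s) \<in> lo ` S \<union> up ` S"
    then show "0 \<le> s \<and> s \<le> int N \<and> (\<forall>j\<in>J. \<bar>r j\<bar> \<le> int N)"
      using assms(3) kN by (auto simp: lo_def up_def J_def)
  next
    fix r c s assume "(r, c, s) \<in> lo ` S \<union> up ` S"
    then show "(\<Sum>j\<in>J. of_int (r j) * z j) \<le> of_int c \<and> (0 < s \<longrightarrow> (\<Sum>j\<in>J. of_int (r j) * z j) < of_int c)"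
    proof (elim UnE imageE)
      fix k assume "(r, c, s) = lo k"
      then show ?thesis
        unfolding sumJ using of_int_floor_le[of "b + (\<Sum>j\<in>I. a j * real (k j))"]
        by (simp add: lo_def z_def m_def sum_negf mult.commute) linarith
    next
      fix k assume "(r, c, s) = up k"
      then show ?thesis
        unfolding sumJ using floor_correct[of "b + (\<Sum>j\<in>I. a j * real (k j))"]
        by (simp add: up_def z_def m_def mult.commute)
    qed
  qed (use assms cJ in auto)
  then obtain w where w: "\<And>r c s. (r, c, s) \<in> lo ` S \<union> up ` S \<Longrightarrow> (\<Sum>j\<in>J. of_int (r j) * w j) + of_int s * e \<le> of_int c"
    unfolding cJ e_def by fastforce
  define A where "A k = w None + (\<Sum>j\<in>I. w (Some j) * real (k j))" for k
  have A: "of_int (m k) \<le> A k" "A k + e \<le> of_int (m k) + 1" if "k \<in> S" for k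
    using w[of "fst (lo k)" "fst (snd (lo k))" "snd (snd (lo k))"] w[of "fst (up k)" "fst (snd (up k))" "snd (snd (up k))"] that
    unfolding sumJ by (auto simp: lo_def up_def A_def sum_negf mult.commute)
  define p0 where "p0 = \<lceil>w None * of_int q\<rceil>"
  define p where "p j = \<lceil>w (Some j) * of_int q\<rceil>" for j
  have qpos: "0 < real_of_int q" using floor_denom_pos by (simp add: q_def)
  have qe: "1 + real (card I * N) < e * of_int q"
  proof -
    define D where "D = (2 * N) ^ 2 ^ Suc (card I)"
    have D: "1 \<le> D" using assms(3) by (simp add: D_def)
    have "(1 + real (card I * N)) * real D < 2 * (1 + real (card I * N)) * real D + 1"
    proof -
      have "0 \<le> (1 + real (card I * N)) * real D" by (intro mult_nonneg_nonneg) auto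
      then show ?thesis unfolding mult.assoc by linarith
    qed
    also have "\<dots> = of_int q"
      unfolding q_def floor_denom_def D_def[symmetric] by (simp add: algebra_simps)
    finally have lt: "(1 + real (card I * N)) * real D < of_int q" .
    have "e = 1 / real D" unfolding e_def D_def ..
    then show ?thesis using D lt by (simp add: pos_less_divide_eq)
  qed
  have "m k * q \<le> p0 + (\<Sum>j\<in>I. p j * int (k j)) \<and> p0 + (\<Sum>j\<in>I. p j * int (k j)) < (m k + 1) * q" if k: "k \<in> S" for k
  proof -
    define R where "R = p0 + (\<Sum>j\<in>I. p j * int (k j))"
    have Aq: "A k * of_int q = w None * of_int q + (\<Sum>j\<in>I. (w (Some j) * of_int q) * real (k j))"
      by (simp add: A_def algebra_simps sum_distrib_left sum_distrib_right)
    have "A k * of_int q \<le> of_int R"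
      unfolding Aq R_def p0_def p_def of_int_add of_int_sum of_int_mult of_int_of_nat_eq
      by (intro add_mono sum_mono mult_right_mono le_of_int_ceiling) auto
    then have 1: "of_int (m k) * of_int q \<le> (of_int R :: real)"
      using A(1)[OF k] qpos by (meson dual_order.trans mult_le_cancel_right_pos)
    have "of_int R \<le> (w None * of_int q + 1) + (\<Sum>j\<in>I. (w (Some j) * of_int q + 1) * real (k j))"
      unfolding R_def p0_def p_def of_int_add of_int_sum of_int_mult of_int_of_nat_eq
      by (intro add_mono sum_mono mult_right_mono of_int_ceiling_le_add_one) auto
    also have "\<dots> = A k * of_int q + 1 + (\<Sum>j\<in>I. real (k j))"
      unfolding Aq by (simp add: algebra_simps sum.distrib)
    also have "(\<Sum>j\<in>I. real (k j)) \<le> (\<Sum>j\<in>I. real N)"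
      using kN k by (intro sum_mono) auto
    finally have "of_int R \<le> A k * of_int q + (1 + real (card I * N))" by simp
    also have "\<dots> < (A k + e) * of_int q" using qe by (simp add: algebra_simps)
    also have "\<dots> \<le> (of_int (m k) + 1) * of_int q"
      using A(2)[OF k] qpos by (intro mult_right_mono) auto
    finally have "of_int R < (of_int ((m k + 1) * q) :: real)" by simp
    moreover have "of_int (m k * q) \<le> (of_int R :: real)" using 1 by simp
    ultimately show ?thesis unfolding R_def[symmetric] of_int_less_iff of_int_le_iff by simp
  qed
  then show ?thesis unfolding m_def by blast
qed

lemma ln_floor_denom_le: "\<exists>E>0. \<forall>N\<ge>1. ln (real (floor_denom m N)) \<le> E * ln (real N + 1)"
proof -
  define E where "E = m + 2 * 2 ^ Suc m + 2"
  have "ln (real (floor_denom m N)) \<le> real E * ln (real N + 1)" if "1 \<le> N" for N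
  proof -
    have "1 + m * N \<le> (N + 1) ^ m"
    proof (induction m)
      case (Suc m)
      have "1 + Suc m * N \<le> (N + 1) * (1 + m * N)" by (simp add: algebra_simps)
      also have "\<dots> \<le> (N + 1) * (N + 1) ^ m" by (rule mult_le_mono2[OF Suc])
      finally show ?case by simp
    qed simp
    moreover have "2 * N \<le> (N + 1) ^ 2" by (simp add: power2_eq_square)
    then have "(2 * N) ^ 2 ^ Suc m \<le> ((N + 1) ^ 2) ^ 2 ^ Suc m" by (rule power_mono) simp
    ultimately have "(1 + m * N) * (2 * N) ^ 2 ^ Suc m \<le> (N + 1) ^ m * ((N + 1) ^ 2) ^ 2 ^ Suc m"
      by (rule mult_mono) auto
    also have "\<dots> = (N + 1) ^ (m + 2 * 2 ^ Suc m)" by (simp only: power_add power_mult)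
    finally have "floor_denom m N \<le> 2 * (N + 1) ^ (m + 2 * 2 ^ Suc m) + 1"
      by (simp add: floor_denom_def)
    also have "\<dots> \<le> 4 * (N + 1) ^ (m + 2 * 2 ^ Suc m)"
      using one_le_power[of "N + 1" "m + 2 * 2 ^ Suc m"] by linarith
    also have "\<dots> \<le> (N + 1) ^ 2 * (N + 1) ^ (m + 2 * 2 ^ Suc m)"
      using power_mono[of 2 "N + 1" 2] that by (intro mult_right_mono) auto
    also have "\<dots> = (N + 1) ^ E" by (simp add: E_def power_add[symmetric] add.commute)
    finally have "floor_denom m N \<le> (N + 1) ^ E" .
    then have "real (floor_denom m N) \<le> (real N + 1) ^ E"
      by (metis of_nat_1 of_nat_add of_nat_le_iff of_nat_power)
    then have "ln (real (floor_denom m N)) \<le> ln ((real N + 1) ^ E)"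
      using floor_denom_pos by (subst ln_le_cancel_iff) auto
    then show ?thesis by (simp add: ln_realpow)
  qed
  moreover have "0 < real E" unfolding E_def of_nat_0_less_iff by simp
  ultimately show ?thesis by blast
qed

section \<open>Discrete Fourier expansion of a floor phase\<close>

lemma sin_ge_two_over_pi:
  assumes "0 \<le> x" "x \<le> pi / 2"
  shows "2 / pi * x \<le> sin x"
proof -
  have "concave_on {0..pi} sin"
    by (rule f''_le0_imp_concave[where f' = cos and f'' = "\<lambda>x. - sin x"])
       (auto intro!: derivative_eq_intros sin_ge_zero)
  then have "(1 - 2 / pi * x) * sin 0 + (2 / pi * x) * sin (pi / 2) \<le> sin ((1 - 2 / pi * x) *\<^sub>R 0 + (2 / pi * x) *\<^sub>R (pi / 2))"
    using assms by (intro concave_onD) (auto simp: field_simps)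
  then show ?thesis by simp
qed

lemma norm_cis_minus_one: "cmod (cis t - 1) = 2 * \<bar>sin (t / 2)\<bar>"
  using dist_exp_i_1[of t] by (simp add: cis_conv_exp)

lemma norm_cis_minus_one_le: "cmod (cis t - 1) \<le> \<bar>t\<bar>"
  unfolding norm_cis_minus_one using abs_sin_x_le_abs_x[of "t / 2"] by simp

lemma norm_cis_minus_one_ge:
  assumes "\<bar>t\<bar> \<le> pi"
  shows "2 / pi * \<bar>t\<bar> \<le> cmod (cis t - 1)"
proof -
  have "2 / pi * (\<bar>t\<bar> / 2) \<le> sin (\<bar>t\<bar> / 2)"
    using assms by (intro sin_ge_two_over_pi) auto
  moreover have "sin (\<bar>t\<bar> / 2) \<le> \<bar>sin (t / 2)\<bar>"
    by (cases "0 \<le> t") auto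
  ultimately have "2 / pi * (\<bar>t\<bar> / 2) \<le> \<bar>sin (t / 2)\<bar>" by (rule order_trans)
  then show ?thesis unfolding norm_cis_minus_one by simp
qed

lemma sum_cis_geometric:
  assumes "cis t \<noteq> 1"
  shows "(\<Sum>r<q. cis (real r * t)) = (cis (real q * t) - 1) / (cis t - 1)"
proof -
  have "(\<Sum>r<q. cis (real r * t)) = (\<Sum>r<q. cis t ^ r)" by (simp add: Complex.DeMoivre)
  also have "\<dots> = (cis t ^ q - 1) / (cis t - 1)" by (rule geometric_sum[OF assms])
  finally show ?thesis by (simp add: Complex.DeMoivre)
qed

lemma sum_cis_roots_of_unity:
  fixes j :: int
  assumes "\<bar>j\<bar> < int (2 * h + 1)"
  shows "(\<Sum>m = - int h..int h. cis (2 * pi * of_int m * of_int j / real (2 * h + 1))) =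
    (if j = 0 then of_nat (2 * h + 1) else 0)"
proof (cases "j = 0")
  case True
  then show ?thesis by simp
next
  case False
  define q where "q = 2 * h + 1"
  define t where "t = 2 * pi * of_int j / real q"
  have q: "0 < real q" by (simp add: q_def)
  have "cis t \<noteq> 1"
  proof
    assume "cis t = 1"
    then obtain n :: int where "t = of_int n * 2 * pi"
      by (auto simp: cis_conv_exp exp_eq_1)
    then have "real_of_int j = of_int n * real q"
      using q by (simp add: t_def field_simps)
    then have "real_of_int j = real_of_int (n * int q)" by simp
    then have "int q dvd j" unfolding of_int_eq_iff by simp
    then show False using assms False dvd_imp_le_int[of j "int q"] by (simp add: q_def)
  qed
  have "(\<Sum>m = - int h..int h. cis (2 * pi * of_int m * of_int j / real q)) =
        (\<Sum>r<q. cis (- (real h * t)) * cis (real r * t))"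
    by (rule sum.reindex_bij_witness[where i = "\<lambda>r. int r - int h" and j = "\<lambda>m. nat (m + int h)"])
       (auto simp: q_def t_def cis_mult divide_simps, auto simp: algebra_simps)
  also have "\<dots> = cis (- (real h * t)) * ((cis (real q * t) - 1) / (cis t - 1))"
    unfolding sum_distrib_left[symmetric] sum_cis_geometric[OF \<open>cis t \<noteq> 1\<close>] ..
  also have "cis (real q * t) = 1"
    using q cis_multiple_2pi[of "of_int j"] by (simp add: t_def)
  finally show ?thesis using False by (simp add: q_def)
qed

text \<open>
  The discrete Fourier coefficients, modulo \<open>q = 2 * h + 1\<close>, of the \<open>q\<close>-periodic sequence that equals
  \<open>cis (- x r / q)\<close> for \<open>0 \<le> r < q\<close>.
\<close>

definition interp_coeff :: "nat \<Rightarrow> real \<Rightarrow> int \<Rightarrow> complex" where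
  "interp_coeff h x m = (\<Sum>r<2 * h + 1. cis (- (real r * (x + 2 * pi * of_int m) / real (2 * h + 1)))) / of_nat (2 * h + 1)"

text \<open>
  Write \<open>p = M q + r\<close> with \<open>0 \<le> r < q\<close>.  Then \<open>cis (x M)\<close> is \<open>cis (x p / q)\<close> times a \<open>q\<close>-periodic function of \<open>p\<close>,
  namely \<open>cis (- x r / q)\<close>, which is expanded by finite Fourier inversion.  As a function of \<open>p\<close> every term on
  the right is a character, whereas \<open>M\<close> depends on \<open>p\<close> through a floor.
\<close>

lemma interp_coeff_expansion:
  fixes M p :: int
  assumes "M * int (2 * h + 1) \<le> p" "p < (M + 1) * int (2 * h + 1)"
  shows "cis (x * of_int M) =
    (\<Sum>m = - int h..int h. interp_coeff h x m * cis ((x + 2 * pi * of_int m) * of_int p / real (2 * h + 1)))"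
proof -
  define q where "q = 2 * h + 1"
  define r where "r = nat (p - M * int q)"
  have q: "0 < real q" by (simp add: q_def)
  have r: "r < q" "p = M * int q + int r"
    using assms by (auto simp: r_def q_def algebra_simps)
  have ph: "cis (- (real r' * (x + 2 * pi * of_int m) / real q)) * cis ((x + 2 * pi * of_int m) * of_int p / real q)
     = cis (x * of_int M) * cis (x * of_int (int r - int r') / real q) * cis (2 * pi * of_int m * of_int (int r - int r') / real q)"
    for r' and m :: int
  proof -
    have "- (real r' * (x + 2 * pi * of_int m) / real q) + (x + 2 * pi * of_int m) * of_int p / real q
      = (x * of_int M + x * of_int (int r - int r') / real q + 2 * pi * of_int m * of_int (int r - int r') / real q) + 2 * pi * of_int (m * M)"
      using q by (simp add: r(2) field_simps)
    then show ?thesis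
      unfolding cis_mult by (metis Ints_of_int cis_mult cis_multiple_2pi mult.right_neutral)
  qed
  have "(\<Sum>m = - int h..int h. interp_coeff h x m * cis ((x + 2 * pi * of_int m) * of_int p / real q)) =
    (\<Sum>m = - int h..int h. \<Sum>r'<q. cis (x * of_int M) * cis (x * of_int (int r - int r') / real q) * cis (2 * pi * of_int m * of_int (int r - int r') / real q) / of_nat q)"
    unfolding interp_coeff_def q_def[symmetric] sum_divide_distrib sum_distrib_right times_divide_eq_left ph ..
  also have "\<dots> = (\<Sum>r'<q. cis (x * of_int M) * cis (x * of_int (int r - int r') / real q) *
      (\<Sum>m = - int h..int h. cis (2 * pi * of_int m * of_int (int r - int r') / real q)) / of_nat q)"
    by (subst sum.swap) (simp add: sum_distrib_left sum_divide_distrib)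
  also have "\<dots> = (\<Sum>r'<q. if r' = r then cis (x * of_int M) else 0)"
  proof (rule sum.cong[OF refl])
    fix r' assume "r' \<in> {..<q}"
    then have "\<bar>int r - int r'\<bar> < int (2 * h + 1)" using r(1) by (auto simp: q_def)
    from sum_cis_roots_of_unity[OF this]
    show "cis (x * of_int M) * cis (x * of_int (int r - int r') / real q) *
      (\<Sum>m = - int h..int h. cis (2 * pi * of_int m * of_int (int r - int r') / real q)) / of_nat q
      = (if r' = r then cis (x * of_int M) else 0)"
      using q unfolding q_def[symmetric] by auto
  qed
  also have "\<dots> = cis (x * of_int M)" using r(1) by simp
  finally show ?thesis by (simp add: q_def)
qed

lemma norm_interp_coeff_le_1: "cmod (interp_coeff h x m) \<le> 1"
proof -
  have "cmod (\<Sum>r<2 * h + 1. cis (- (real r * (x + 2 * pi * of_int m) / real (2 * h + 1)))) \<le> (\<Sum>r<2 * h + 1. 1)"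
    by (rule order_trans[OF norm_sum]) simp
  then show ?thesis by (simp add: interp_coeff_def norm_divide divide_simps del: of_nat_Suc of_nat_mult of_nat_add)
qed

text \<open>
  The geometric sum has numerator \<open>cis (- x) - 1\<close>, of size at most \<open>\<bar>x\<bar>\<close>: the coefficients other than the
  one at \<open>m = 0\<close> are small for small \<open>x\<close>.
\<close>

lemma norm_interp_coeff_le:
  assumes "\<bar>x\<bar> \<le> pi" "m \<noteq> 0" "\<bar>m\<bar> \<le> int h"
  shows "cmod (interp_coeff h x m) \<le> \<bar>x\<bar> / (2 * of_int \<bar>m\<bar>)"
proof -
  define q where "q = 2 * h + 1"
  define y where "y = x + 2 * pi * of_int m"
  define t where "t = - (y / real q)"
  have q: "0 < real q" by (simp add: q_def)
  have m1: "1 \<le> real_of_int \<bar>m\<bar>" using assms(2) by linarith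
  have "2 * pi * of_int \<bar>m\<bar> = \<bar>2 * pi * of_int m\<bar>" by (simp add: abs_mult)
  then have f1: "2 * pi * of_int \<bar>m\<bar> \<le> \<bar>y\<bar> + pi" "\<bar>y\<bar> \<le> 2 * pi * of_int \<bar>m\<bar> + pi"
    using assms(1) unfolding y_def by linarith+
  have "pi * 1 \<le> pi * of_int \<bar>m\<bar>" using m1 by (intro mult_left_mono) auto
  then have y1: "pi * of_int \<bar>m\<bar> \<le> \<bar>y\<bar>" using f1(1) by linarith
  have "real_of_int \<bar>m\<bar> \<le> real h" using assms(3) by linarith
  then have "pi * of_int \<bar>m\<bar> \<le> pi * real h" by (intro mult_left_mono) auto
  moreover have "pi * real q = 2 * (pi * real h) + pi" by (simp add: q_def distrib_left)
  ultimately have "\<bar>y\<bar> \<le> pi * real q" using f1(2) by linarith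
  note y = y1 this
  have y0: "0 < \<bar>y\<bar>" using y(1) m1 by (smt (verit) mult_pos_pos pi_gt_zero)
  have tge: "2 / pi * (\<bar>y\<bar> / real q) \<le> cmod (cis t - 1)"
    using norm_cis_minus_one_ge[of t] y(2) q by (simp add: t_def field_simps)
  have "0 < 2 / pi * (\<bar>y\<bar> / real q)" using y0 q by simp
  then have "cis t \<noteq> 1" using tge by auto
  have "interp_coeff h x m = (\<Sum>r<q. cis (real r * t)) / of_nat q"
    by (simp add: interp_coeff_def q_def t_def y_def)
  also have "\<dots> = (cis (real q * t) - 1) / (cis t - 1) / of_nat q"
    by (simp add: sum_cis_geometric[OF \<open>cis t \<noteq> 1\<close>])
  also have "cis (real q * t) = cis (- x)"
  proof -
    have "real q * t = - x - 2 * pi * of_int m" using q by (simp add: t_def y_def)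
    then show ?thesis using cis_multiple_2pi[of "of_int m"] by (simp add: cis_divide[symmetric])
  qed
  finally have "cmod (interp_coeff h x m) = cmod (cis (- x) - 1) / cmod (cis t - 1) / real q"
    by (simp only: norm_divide norm_of_nat)
  also have "\<dots> \<le> \<bar>x\<bar> / (2 / pi * (\<bar>y\<bar> / real q)) / real q"
    using norm_cis_minus_one_le[of "- x"] tge y0 q by (intro divide_right_mono frac_le) auto
  also have "\<dots> = pi * \<bar>x\<bar> / (2 * \<bar>y\<bar>)" using q y0 by (simp add: field_simps)
  also have "\<dots> \<le> pi * \<bar>x\<bar> / (2 * (pi * of_int \<bar>m\<bar>))"
    using y(1) m1 y0 by (intro divide_left_mono) auto
  also have "\<dots> = \<bar>x\<bar> / (2 * of_int \<bar>m\<bar>)" by simp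
  finally show ?thesis .
qed

lemma harm_le_ln: "harm (Suc n) \<le> 1 + ln (real (Suc n))"
proof (induction n)
  case (Suc n)
  have "ln (real (Suc n) / real (Suc (Suc n))) \<le> real (Suc n) / real (Suc (Suc n)) - 1"
    by (rule ln_le_minus_one) simp
  then have "inverse (real (Suc (Suc n))) \<le> ln (real (Suc (Suc n))) - ln (real (Suc n))"
    by (simp add: ln_div field_simps)
  then show ?case using Suc.IH unfolding harm_Suc[of "Suc n"] by linarith
qed (simp add: harm_def)

lemma sum_norm_interp_coeff_le:
  assumes "\<bar>x\<bar> \<le> pi"
  shows "(\<Sum>m = - int h..int h. cmod (interp_coeff h x m)) \<le> 1 + \<bar>x\<bar> * (1 + ln (real (2 * h + 1)))"
proof -
  have "{- int h..int h} = insert 0 ((int ` {1..h}) \<union> ((\<lambda>k. - int k) ` {1..h}))" (is "_ = insert 0 (?A \<union> ?B)")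
  proof (intro equalityI subsetI)
    fix m assume "m \<in> {- int h..int h}"
    then show "m \<in> insert 0 (?A \<union> ?B)"
      by (cases m rule: int_cases2) (auto simp: image_iff)
  qed auto
  then have "(\<Sum>m = - int h..int h. cmod (interp_coeff h x m)) = cmod (interp_coeff h x 0) + (\<Sum>m\<in>?A \<union> ?B. cmod (interp_coeff h x m))"
    by (simp add: image_iff)
  also have "(\<Sum>m\<in>?A \<union> ?B. cmod (interp_coeff h x m)) = (\<Sum>k=1..h. cmod (interp_coeff h x (int k))) + (\<Sum>k=1..h. cmod (interp_coeff h x (- int k)))"
    by (subst sum.union_disjoint) (auto simp: sum.reindex inj_on_def)
  also have "(\<Sum>k=1..h. cmod (interp_coeff h x (int k))) \<le> (\<Sum>k=1..h. \<bar>x\<bar> / (2 * real k))"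
    using norm_interp_coeff_le[OF assms, of "int _" h] by (intro sum_mono) auto
  also have "(\<Sum>k=1..h. cmod (interp_coeff h x (- int k))) \<le> (\<Sum>k=1..h. \<bar>x\<bar> / (2 * real k))"
    using norm_interp_coeff_le[OF assms, of "- int _" h] by (intro sum_mono) auto
  also have "(\<Sum>k=1..h. \<bar>x\<bar> / (2 * real k)) + (\<Sum>k=1..h. \<bar>x\<bar> / (2 * real k)) = \<bar>x\<bar> * harm h"
    unfolding sum.distrib[symmetric] harm_def sum_distrib_left by (intro sum.cong) (auto simp: field_simps)
  also have "\<bar>x\<bar> * harm h \<le> \<bar>x\<bar> * (1 + ln (real (2 * h + 1)))"
  proof (intro mult_left_mono)
    have "harm h \<le> (harm (Suc (2 * h)) :: real)" by (intro harm_mono) simp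
    then show "harm h \<le> 1 + ln (real (2 * h + 1))" using harm_le_ln[of "2 * h"] by simp
  qed simp
  finally show ?thesis using norm_interp_coeff_le_1[of h x 0] by simp
qed

section \<open>The \<open>L\<^sup>1\<close> norm of a trigonometric sum\<close>

definition circle :: "real measure" where
  "circle = density lborel (indicator {-pi<..pi})"

lemma sets_circle [measurable_cong, simp]: "sets circle = sets borel"
  by (simp add: circle_def)

lemma space_circle [simp]: "space circle = UNIV"
  by (simp add: circle_def)

lemma nn_integral_circle:
  assumes "f \<in> borel_measurable borel"
  shows "(\<integral>\<^sup>+t. f t \<partial>circle) = (\<integral>\<^sup>+t. f t * indicator {-pi<..pi} t \<partial>lborel)"
  using assms unfolding circle_def by (subst nn_integral_density) (auto simp: mult.commute)

lemma emeasure_circle: "emeasure circle UNIV = ennreal (2 * pi)"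
proof -
  have "emeasure circle UNIV = (\<integral>\<^sup>+t. 1 \<partial>circle)" by simp
  also have "\<dots> = ennreal (2 * pi)" by (subst nn_integral_circle) auto
  finally show ?thesis .
qed

interpretation circle: finite_measure circle
  by standard (simp add: emeasure_circle)

interpretation circles: product_sigma_finite "\<lambda>_ :: 'i. circle"
  by standard

lemma nn_integral_circle_shift:
  fixes f :: "real \<Rightarrow> ennreal"
  assumes [measurable]: "f \<in> borel_measurable borel" and per: "\<And>x. f (x + 2 * pi) = f x"
  shows "(\<integral>\<^sup>+x. f (x + y) \<partial>circle) = (\<integral>\<^sup>+x. f x \<partial>circle)"
proof -
  define F where "F a b = (\<integral>\<^sup>+x. f x * indicator {a<..b} x \<partial>lborel)" for a b :: real
  have shift: "(\<integral>\<^sup>+x. g (x + c) * indicator {a<..b} x \<partial>lborel) = (\<integral>\<^sup>+x. g x * indicator {a + c<..b + c} x \<partial>lborel)"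
    if [measurable]: "g \<in> borel_measurable borel" for a b c and g :: "real \<Rightarrow> ennreal"
    by (subst (2) nn_integral_real_affine[where c = 1 and t = c])
       (auto simp: add.commute indicator_def intro!: nn_integral_cong)
  have add: "F a c = F a b + F b c" if "a \<le> b" "b \<le> c" for a b c
    unfolding F_def using that
    by (subst nn_integral_add[symmetric]) (auto simp: indicator_def intro!: nn_integral_cong)
  have per': "f (x + of_int k * (2 * pi)) = f x" for x and k :: int
  proof -
    have nat: "f (x + of_nat n * (2 * pi)) = f x" for n x
    proof (induction n)
      case (Suc n)
      have "f (x + of_nat (Suc n) * (2 * pi)) = f ((x + of_nat n * (2 * pi)) + 2 * pi)"
        by (simp add: algebra_simps)
      then show ?case unfolding per using Suc by simp
    qed simp
    show ?thesis
    proof (cases k rule: int_cases2)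
      case (nonneg n)
      then show ?thesis using nat[of x n] by simp
    next
      case (nonpos n)
      then show ?thesis using nat[of "x - of_nat n * (2 * pi)" n] by simp
    qed
  qed
  define k where "k = \<lfloor>y / (2 * pi)\<rfloor>"
  define r where "r = y - of_int k * (2 * pi)"
  have r: "0 \<le> r" "r < 2 * pi"
  proof -
    have "of_int k \<le> y / (2 * pi)" "y / (2 * pi) < of_int k + 1"
      unfolding k_def by linarith+
    then show "0 \<le> r" "r < 2 * pi"
      by (simp_all add: r_def pos_le_divide_eq pos_divide_less_eq distrib_right)
  qed
  have "f (x + y) = f (x + r)" for x
    using per'[of "x + r" k] by (simp add: r_def algebra_simps)
  then have "(\<integral>\<^sup>+x. f (x + y) \<partial>circle) = (\<integral>\<^sup>+x. f (x + r) * indicator {-pi<..pi} x \<partial>lborel)"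
    by (simp add: nn_integral_circle)
  also have "\<dots> = F (- pi + r) (pi + r)" unfolding F_def by (rule shift) simp
  also have "\<dots> = F (- pi + r) pi + F pi (pi + r)" using r by (intro add) auto
  also have "F pi (pi + r) = F (- pi) (- pi + r)"
    using shift[of f "2 * pi" "- pi" "- pi + r"] unfolding F_def per by (simp add: algebra_simps)
  also have "F (- pi + r) pi + F (- pi) (- pi + r) = F (- pi) pi"
    using r add[of "- pi" "- pi + r" pi] by (simp add: add.commute)
  finally show ?thesis by (simp add: F_def nn_integral_circle)
qed

text \<open>
  The coefficients are an argument because integrating out one variable leaves a sum in the other variables whose coefficients depend
  on the first.
\<close>

definition trig_L1 :: "'i set \<Rightarrow> ('i \<Rightarrow> nat) set \<Rightarrow> (('i \<Rightarrow> nat) \<Rightarrow> complex) \<Rightarrow> ennreal" where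
  "trig_L1 I S c =
     (\<integral>\<^sup>+x. ennreal (cmod (\<Sum>k\<in>S. c k * cis (\<Sum>j\<in>I. real (k j) * x j))) \<partial>PiM I (\<lambda>_. circle))"

lemma cis_measurable [measurable]: "cis \<in> borel_measurable borel"
  by (intro borel_measurable_continuous_onI continuous_intros)

lemma trig_L1_cong: "(\<And>k. k \<in> S \<Longrightarrow> c k = c' k) \<Longrightarrow> trig_L1 I S c = trig_L1 I S c'"
  unfolding trig_L1_def by (intro nn_integral_cong arg_cong[where f = "\<lambda>z. ennreal (cmod z)"] sum.cong) auto

lemma trig_L1_empty: "trig_L1 {} S c = ennreal (cmod (\<Sum>k\<in>S. c k))"
  unfolding trig_L1_def by (simp add: PiM_empty nn_integral_count_space_finite)

lemma trig_L1_measurable: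
  assumes [measurable]: "\<And>k. (\<lambda>t. c t k) \<in> borel_measurable M"
  shows "(\<lambda>t. trig_L1 I S (c t)) \<in> borel_measurable M"
proof (cases "finite I")
  case True
  interpret finite_product_sigma_finite "\<lambda>_. circle" I by standard (rule True)
  show ?thesis unfolding trig_L1_def
    by (intro borel_measurable_nn_integral) measurable
next
  case False
  then show ?thesis unfolding trig_L1_def by simp
qed

lemma trig_L1_insert:
  assumes "finite I" "i \<notin> I"
  shows "trig_L1 (insert i I) S c = (\<integral>\<^sup>+t. trig_L1 I S (\<lambda>k. c k * cis (real (k i) * t)) \<partial>circle)"
proof -
  have eq: "(\<Sum>j\<in>insert i I. real (k j) * (x(i := t)) j) = real (k i) * t + (\<Sum>j\<in>I. real (k j) * x j)" for k x t
    using assms by (auto intro!: sum.cong)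
  show ?thesis
    unfolding trig_L1_def
    by (subst circles.product_nn_integral_insert_rev[OF assms])
       (simp_all only: eq cis_mult[symmetric] mult.assoc, measurable)
qed

lemma trig_L1_scale: "trig_L1 I S (\<lambda>k. a * c k) = ennreal (cmod a) * trig_L1 I S c"
proof -
  have "trig_L1 I S (\<lambda>k. a * c k) =
    (\<integral>\<^sup>+x. ennreal (cmod a) * ennreal (cmod (\<Sum>k\<in>S. c k * cis (\<Sum>j\<in>I. real (k j) * x j))) \<partial>PiM I (\<lambda>_. circle))"
    unfolding trig_L1_def by (simp add: mult.assoc sum_distrib_left[symmetric] norm_mult ennreal_mult)
  also have "\<dots> = ennreal (cmod a) * trig_L1 I S c"
    unfolding trig_L1_def by (rule nn_integral_cmult) measurable
  finally show ?thesis .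
qed

lemma trig_L1_sum_le:
  assumes "finite A"
  shows "trig_L1 I S (\<lambda>k. \<Sum>m\<in>A. c m k) \<le> (\<Sum>m\<in>A. trig_L1 I S (c m))"
proof -
  have "trig_L1 I S (\<lambda>k. \<Sum>m\<in>A. c m k) \<le>
    (\<integral>\<^sup>+x. (\<Sum>m\<in>A. ennreal (cmod (\<Sum>k\<in>S. c m k * cis (\<Sum>j\<in>I. real (k j) * x j)))) \<partial>PiM I (\<lambda>_. circle))"
    unfolding trig_L1_def
  proof (intro nn_integral_mono)
    fix x
    have "(\<Sum>k\<in>S. (\<Sum>m\<in>A. c m k) * cis (\<Sum>j\<in>I. real (k j) * x j)) = (\<Sum>m\<in>A. \<Sum>k\<in>S. c m k * cis (\<Sum>j\<in>I. real (k j) * x j))"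
      unfolding sum_distrib_right by (rule sum.swap)
    then show "ennreal (cmod (\<Sum>k\<in>S. (\<Sum>m\<in>A. c m k) * cis (\<Sum>j\<in>I. real (k j) * x j))) \<le>
       (\<Sum>m\<in>A. ennreal (cmod (\<Sum>k\<in>S. c m k * cis (\<Sum>j\<in>I. real (k j) * x j))))"
      by (simp add: sum_ennreal norm_sum ennreal_leI)
  qed
  also have "\<dots> = (\<Sum>m\<in>A. trig_L1 I S (c m))"
    unfolding trig_L1_def by (rule nn_integral_sum) measurable
  finally show ?thesis .
qed

text \<open>
  Modulating the coefficients by a character translates the sum, and the torus is
  translation invariant.
\<close>

lemma trig_L1_modulate:
  assumes "finite I"
  shows "trig_L1 I S (\<lambda>k. c k * cis (\<Sum>j\<in>I. real (k j) * y j)) = trig_L1 I S c"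
  using assms
proof (induction I arbitrary: c rule: finite_induct)
  case empty
  then show ?case by simp
next
  case (insert i I)
  have per: "cis (real n * (t + 2 * pi)) = cis (real n * t)" for n t
    using cis_multiple_2pi[of "real n"] by (simp add: distrib_left cis_mult[symmetric] mult.commute)
  have "trig_L1 (insert i I) S (\<lambda>k. c k * cis (\<Sum>j\<in>insert i I. real (k j) * y j)) =
    (\<integral>\<^sup>+t. trig_L1 I S (\<lambda>k. (c k * cis (real (k i) * (t + y i))) * cis (\<Sum>j\<in>I. real (k j) * y j)) \<partial>circle)"
    unfolding trig_L1_insert[OF insert.hyps]
    using insert.hyps by (intro nn_integral_cong trig_L1_cong) (simp add: cis_mult algebra_simps)
  also have "\<dots> = (\<integral>\<^sup>+t. trig_L1 I S (\<lambda>k. c k * cis (real (k i) * (t + y i))) \<partial>circle)"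
    unfolding insert.IH ..
  also have "\<dots> = (\<integral>\<^sup>+t. trig_L1 I S (\<lambda>k. c k * cis (real (k i) * t)) \<partial>circle)"
    by (rule nn_integral_circle_shift) (auto simp: per intro!: trig_L1_measurable)
  finally show ?case unfolding trig_L1_insert[OF insert.hyps] .
qed

lemma trig_L1_add_le: "trig_L1 I S (\<lambda>k. c k + c' k) \<le> trig_L1 I S c + trig_L1 I S c'"
  using trig_L1_sum_le[of "{False, True}" I S "\<lambda>b. if b then c' else c"] by simp

text \<open>
  Each term of the discrete Fourier expansion is a character in \<open>k\<close>, so it contributes only the modulus of
  its coefficient.
\<close>

lemma trig_L1_floor_modulation_le:
  fixes a :: "'i \<Rightarrow> real" and b x :: real
  assumes "finite I" "finite S" "1 \<le> N" "\<And>k j. k \<in> S \<Longrightarrow> j \<in> I \<Longrightarrow> k j \<le> N" and x: "\<bar>x\<bar> \<le> pi"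
  shows "trig_L1 I S (\<lambda>k. cis (x * of_int \<lfloor>b + (\<Sum>j\<in>I. a j * real (k j))\<rfloor>))
    \<le> ennreal (1 + \<bar>x\<bar> * (1 + ln (real (floor_denom (card I) N)))) * trig_L1 I S (\<lambda>_. 1)"
proof -
  define h where "h = (1 + card I * N) * (2 * N) ^ 2 ^ Suc (card I)"
  have q: "floor_denom (card I) N = 2 * h + 1" by (simp add: floor_denom_def h_def)
  obtain p :: "'i \<Rightarrow> int" and p0 where p:
    "\<And>k. k \<in> S \<Longrightarrow> \<lfloor>b + (\<Sum>j\<in>I. a j * real (k j))\<rfloor> * int (2 * h + 1) \<le> p0 + (\<Sum>j\<in>I. p j * int (k j))"
    "\<And>k. k \<in> S \<Longrightarrow> p0 + (\<Sum>j\<in>I. p j * int (k j)) < (\<lfloor>b + (\<Sum>j\<in>I. a j * real (k j))\<rfloor> + 1) * int (2 * h + 1)"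
  proof -
    have "\<exists>(p :: 'i \<Rightarrow> int) p0. \<forall>k\<in>S.
     \<lfloor>b + (\<Sum>j\<in>I. a j * real (k j))\<rfloor> * int (floor_denom (card I) N) \<le> p0 + (\<Sum>j\<in>I. p j * int (k j)) \<and>
     p0 + (\<Sum>j\<in>I. p j * int (k j)) < (\<lfloor>b + (\<Sum>j\<in>I. a j * real (k j))\<rfloor> + 1) * int (floor_denom (card I) N)"
      using assms(1-4) by (rule rational_affine_same_floor)
    then show thesis using that unfolding q by blast
  qed
  define y where "y m = (x + 2 * pi * of_int m) / real (2 * h + 1)" for m :: int
  have "trig_L1 I S (\<lambda>k. cis (x * of_int \<lfloor>b + (\<Sum>j\<in>I. a j * real (k j))\<rfloor>)) =
    trig_L1 I S (\<lambda>k. \<Sum>m = - int h..int h.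
      (interp_coeff h x m * cis (y m * of_int p0)) * (1 * cis (\<Sum>j\<in>I. real (k j) * (y m * of_int (p j)))))"
  proof (rule trig_L1_cong)
    fix k assume k: "k \<in> S"
    have "cis ((x + 2 * pi * of_int m) * of_int (p0 + (\<Sum>j\<in>I. p j * int (k j))) / real (2 * h + 1)) =
       cis (y m * of_int p0) * cis (\<Sum>j\<in>I. real (k j) * (y m * of_int (p j)))" for m
      unfolding cis_mult y_def by (simp add: distrib_left sum_distrib_left add_divide_distrib sum_divide_distrib mult_ac)
    then show "cis (x * of_int \<lfloor>b + (\<Sum>j\<in>I. a j * real (k j))\<rfloor>) = (\<Sum>m = - int h..int h.
      (interp_coeff h x m * cis (y m * of_int p0)) * (1 * cis (\<Sum>j\<in>I. real (k j) * (y m * of_int (p j)))))"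
      unfolding interp_coeff_expansion[OF p[OF k]] by (simp add: mult.assoc)
  qed
  also have "\<dots> \<le> (\<Sum>m = - int h..int h. ennreal (cmod (interp_coeff h x m)) * trig_L1 I S (\<lambda>_. 1))"
  proof (rule order_trans[OF trig_L1_sum_le])
    have "trig_L1 I S (\<lambda>k. (interp_coeff h x m * cis (y m * of_int p0)) * (1 * cis (\<Sum>j\<in>I. real (k j) * (y m * of_int (p j)))))
      = ennreal (cmod (interp_coeff h x m)) * trig_L1 I S (\<lambda>_. 1)" for m
      unfolding trig_L1_scale[of I S "interp_coeff h x m * cis (y m * of_int p0)"] trig_L1_modulate[OF assms(1)]
      by (simp add: norm_mult)
    then show "(\<Sum>m = - int h..int h. trig_L1 I S (\<lambda>k. (interp_coeff h x m * cis (y m * of_int p0)) *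
        (1 * cis (\<Sum>j\<in>I. real (k j) * (y m * of_int (p j))))))
      \<le> (\<Sum>m = - int h..int h. ennreal (cmod (interp_coeff h x m)) * trig_L1 I S (\<lambda>_. 1))"
      by simp
  qed simp
  also have "\<dots> = ennreal (\<Sum>m = - int h..int h. cmod (interp_coeff h x m)) * trig_L1 I S (\<lambda>_. 1)"
    by (simp add: sum_distrib_right[symmetric])
  also have "\<dots> \<le> ennreal (1 + \<bar>x\<bar> * (1 + ln (real (floor_denom (card I) N)))) * trig_L1 I S (\<lambda>_. 1)"
    unfolding q by (intro mult_right_mono ennreal_leI sum_norm_interp_coeff_le x) auto
  finally show ?thesis .
qed

section \<open>Slices and columns of a lattice simplex\<close>

text \<open>
  The level \<open>t\<close> makes the family closed under slicing: fixing one coordinate lowers \<open>t\<close> and keeps the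
  remaining \<open>n j\<close>.  Points vanish outside \<open>I\<close>, so that simplices of all dimensions live in one type.
\<close>

definition lattice_simplex :: "'i set \<Rightarrow> ('i \<Rightarrow> real) \<Rightarrow> real \<Rightarrow> ('i \<Rightarrow> nat) set" where
  "lattice_simplex I n t = {k. (\<forall>j. j \<notin> I \<longrightarrow> k j = 0) \<and> (\<Sum>j\<in>I. real (k j) / n j) \<le> t}"

lemma lattice_simplex_le:
  assumes "finite I" "\<And>j. j \<in> I \<Longrightarrow> 0 < n j" "k \<in> lattice_simplex I n t" "j \<in> I"
  shows "real (k j) \<le> t * n j"
proof -
  have "real (k j) / n j \<le> (\<Sum>j\<in>I. real (k j) / n j)"
    using assms by (intro member_le_sum) (auto intro!: divide_nonneg_pos)
  also have "\<dots> \<le> t" using assms by (simp add: lattice_simplex_def)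
  finally show ?thesis using assms by (simp add: pos_divide_le_eq)
qed

lemma finite_lattice_simplex:
  assumes "finite I" "\<And>j. j \<in> I \<Longrightarrow> 0 < n j"
  shows "finite (lattice_simplex I n t)"
proof -
  define B where "B = nat \<lfloor>\<Sum>j\<in>I. \<bar>t * n j\<bar>\<rfloor>"
  have "k j \<le> B" if "k \<in> lattice_simplex I n t" "j \<in> I" for k j
  proof -
    have "real (k j) \<le> \<bar>t * n j\<bar>"
      using lattice_simplex_le[OF assms that] by linarith
    also have "\<dots> \<le> (\<Sum>j\<in>I. \<bar>t * n j\<bar>)" using assms that by (intro member_le_sum) auto
    finally show ?thesis unfolding B_def by (simp add: le_nat_iff le_floor_iff)
  qed
  then have "lattice_simplex I n t \<subseteq> {k. \<forall>j. (j \<in> I \<longrightarrow> k j \<in> {..B}) \<and> (j \<notin> I \<longrightarrow> k j = 0)}"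
    by (auto simp: lattice_simplex_def)
  then show ?thesis
    using finite_set_of_finite_funs[OF assms(1), of "{..B}" 0] finite_subset by blast
qed

text \<open>
  The largest value of coordinate \<open>d\<close> above the point \<open>k\<close>.  It is written as the floor of a constant plus
  a linear form in \<open>k\<close>, the shape to which the floor modulation bound applies.
\<close>

definition column_floor :: "'i set \<Rightarrow> ('i \<Rightarrow> real) \<Rightarrow> real \<Rightarrow> 'i \<Rightarrow> ('i \<Rightarrow> nat) \<Rightarrow> int" where
  "column_floor I n t d k = \<lfloor>n d * t + (\<Sum>j\<in>I. (- n d / n j) * real (k j))\<rfloor>"

lemma le_column_floor_iff:
  assumes "0 < n d"
  shows "int m \<le> column_floor I n t d k \<longleftrightarrow> (\<Sum>j\<in>I. real (k j) / n j) \<le> t - real m / n d"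
proof -
  have "(\<Sum>j\<in>I. (- n d / n j) * real (k j)) = - (n d * (\<Sum>j\<in>I. real (k j) / n j))"
    by (simp add: sum_distrib_left sum_negf[symmetric])
  then show ?thesis using assms
    by (simp add: column_floor_def le_floor_iff field_simps)
qed

lemma sum_lattice_simplex_insert:
  fixes f :: "('i \<Rightarrow> nat) \<Rightarrow> 'a::comm_monoid_add"
  assumes "finite I" "d \<notin> I" "\<forall>j\<in>insert d I. 0 < n j"
  shows "(\<Sum>k\<in>lattice_simplex (insert d I) n t. f k) =
    (\<Sum>k\<in>lattice_simplex I n t. \<Sum>m<nat (column_floor I n t d k + 1). f (k(d := m)))"
proof -
  have fin: "finite (lattice_simplex I n t)" using assms by (intro finite_lattice_simplex) auto
  have mem: "m < nat (column_floor I n t d k + 1) \<longleftrightarrow> (\<Sum>j\<in>I. real (k j) / n j) + real m / n d \<le> t" for m k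
  proof -
    have "m < nat (column_floor I n t d k + 1) \<longleftrightarrow> int m \<le> column_floor I n t d k" by linarith
    then show ?thesis using le_column_floor_iff[of n d m I t k] assms by auto
  qed
  have upd: "(\<Sum>j\<in>I. real ((k(d := m)) j) / n j) = (\<Sum>j\<in>I. real (k j) / n j)" for k m
    using assms by (intro sum.cong) auto
  have split: "(\<Sum>j\<in>insert d I. real (k j) / n j) = real (k d) / n d + (\<Sum>j\<in>I. real (k j) / n j)" for k
    using assms by simp
  have "(\<Sum>k\<in>lattice_simplex I n t. \<Sum>m<nat (column_floor I n t d k + 1). f (k(d := m))) =
    (\<Sum>(k, m)\<in>Sigma (lattice_simplex I n t) (\<lambda>k. {..<nat (column_floor I n t d k + 1)}). f (k(d := m)))"
    using fin by (subst sum.Sigma) auto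
  also have "\<dots> = (\<Sum>k\<in>lattice_simplex (insert d I) n t. f k)"
  proof (rule sum.reindex_bij_witness[where j = "\<lambda>(k, m). k(d := m)" and i = "\<lambda>k. (k(d := 0), k d)"])
    fix k assume k: "k \<in> lattice_simplex (insert d I) n t"
    have "0 \<le> real (k d) / n d" using assms by (simp add: less_imp_le)
    then show "(k(d := 0), k d) \<in> Sigma (lattice_simplex I n t) (\<lambda>k. {..<nat (column_floor I n t d k + 1)})"
      using k unfolding lattice_simplex_def mem_Sigma_iff lessThan_iff mem upd mem_Collect_eq split by auto
  next
    fix a assume "a \<in> Sigma (lattice_simplex I n t) (\<lambda>k. {..<nat (column_floor I n t d k + 1)})"
    then obtain k m where a: "a = (k, m)" "k \<in> lattice_simplex I n t" "m < nat (column_floor I n t d k + 1)"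
      by auto
    show "(case a of (k, m) \<Rightarrow> k(d := m)) \<in> lattice_simplex (insert d I) n t"
      using a(2,3) unfolding a(1) lattice_simplex_def mem mem_Collect_eq split prod.case upd by auto
    show "((case a of (k, m) \<Rightarrow> k(d := m))(d := 0), (case a of (k, m) \<Rightarrow> k(d := m)) d) = a"
      using a(1,2) assms(2) by (auto simp: lattice_simplex_def)
  qed auto
  finally show ?thesis ..
qed

lemma trig_L1_lattice_simplex_insert:
  assumes "finite I" "d \<notin> I" "\<forall>j\<in>insert d I. 0 < n j"
  shows "trig_L1 I (lattice_simplex (insert d I) n t) (\<lambda>k. cis (real (k d) * x)) =
    trig_L1 I (lattice_simplex I n t) (\<lambda>k. \<Sum>m<nat (column_floor I n t d k + 1). cis (real m * x))"
proof -
  have upd: "(\<Sum>j\<in>I. real ((k(d := m)) j) * y j) = (\<Sum>j\<in>I. real (k j) * y j)" for k m y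
    using assms by (intro sum.cong) auto
  show ?thesis
    unfolding trig_L1_def sum_lattice_simplex_insert[OF assms] upd sum_distrib_right by simp
qed

text \<open>
  This bound is used for \<open>\<bar>x\<bar> \<le> 1 / N\<close>, where dividing by \<open>cis x - 1\<close> would lose integrability.
\<close>

lemma trig_L1_slices_le:
  assumes "finite I" "d \<notin> I" "\<And>j. j \<in> insert d I \<Longrightarrow> 0 < n j"
    and K: "\<And>t. 0 \<le> t \<Longrightarrow> t \<le> 1 \<Longrightarrow> trig_L1 I (lattice_simplex I n t) (\<lambda>_. 1) \<le> K"
    and t: "0 \<le> t" "t \<le> 1" and N: "n d \<le> real N"
  shows "trig_L1 I (lattice_simplex (insert d I) n t) (\<lambda>k. cis (real (k d) * x)) \<le> ennreal (real (N + 1)) * K"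
proof -
  let ?S = "lattice_simplex I n t"
  have nd: "0 < n d" using assms(3) by simp
  have npos: "\<forall>j\<in>insert d I. 0 < n j" using assms(3) by blast
  have fin: "finite ?S" using assms by (intro finite_lattice_simplex) auto
  have bound: "nat (column_floor I n t d k + 1) \<le> N + 1" if "k \<in> ?S" for k
  proof -
    have "0 \<le> (\<Sum>j\<in>I. real (k j) / n j)" using assms(3) by (intro sum_nonneg) (auto intro!: divide_nonneg_pos)
    then have "0 \<le> n d * (\<Sum>j\<in>I. real (k j) / n j)" using nd by simp
    moreover have "(\<Sum>j\<in>I. (- n d / n j) * real (k j)) = - (n d * (\<Sum>j\<in>I. real (k j) / n j))"
      by (simp add: sum_distrib_left sum_negf[symmetric])
    moreover have "n d * t \<le> n d" using t nd by (simp add: mult_left_le)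
    ultimately have "n d * t + (\<Sum>j\<in>I. (- n d / n j) * real (k j)) \<le> real N" using N by linarith
    then have "column_floor I n t d k \<le> int N" unfolding column_floor_def by linarith
    then show ?thesis by linarith
  qed
  have "trig_L1 I (lattice_simplex (insert d I) n t) (\<lambda>k. cis (real (k d) * x)) =
    trig_L1 I ?S (\<lambda>k. \<Sum>m<N + 1. if int m \<le> column_floor I n t d k then cis (real m * x) else 0)"
    unfolding trig_L1_lattice_simplex_insert[OF assms(1,2) npos]
  proof (rule trig_L1_cong)
    fix k assume "k \<in> ?S"
    then have "{..<nat (column_floor I n t d k + 1)} = {m \<in> {..<N + 1}. int m \<le> column_floor I n t d k}"
      using bound by force
    then show "(\<Sum>m<nat (column_floor I n t d k + 1). cis (real m * x)) =
      (\<Sum>m<N + 1. if int m \<le> column_floor I n t d k then cis (real m * x) else 0)"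
      by (simp only: sum.inter_filter finite_lessThan)
  qed
  also have "\<dots> \<le> (\<Sum>m<N + 1. trig_L1 I ?S (\<lambda>k. if int m \<le> column_floor I n t d k then cis (real m * x) else 0))"
    by (rule trig_L1_sum_le) simp
  also have "\<dots> \<le> (\<Sum>m<N + 1. K)"
  proof (rule sum_mono)
    fix m
    let ?t = "t - real m / n d"
    have le: "?t \<le> t" using nd by simp
    have eq: "{k \<in> ?S. int m \<le> column_floor I n t d k} = lattice_simplex I n ?t"
      using le unfolding le_column_floor_iff[where n = n and d = d and I = I, OF nd] lattice_simplex_def by auto
    have "trig_L1 I ?S (\<lambda>k. if int m \<le> column_floor I n t d k then cis (real m * x) else 0) =
      trig_L1 I (lattice_simplex I n ?t) (\<lambda>k. cis (real m * x) * 1)"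
      unfolding trig_L1_def eq[symmetric] using fin
      by (simp add: sum.inter_filter[symmetric] if_distrib[of "\<lambda>u. u * _"] cong: if_cong)
    also have "\<dots> \<le> K"
    proof (cases "0 \<le> ?t")
      case True
      then show ?thesis using K[of ?t] le t unfolding trig_L1_scale by simp
    next
      case False
      have "lattice_simplex I n ?t = {}"
      proof (rule ccontr)
        assume "lattice_simplex I n ?t \<noteq> {}"
        then obtain k where "(\<Sum>j\<in>I. real (k j) / n j) \<le> ?t" by (auto simp: lattice_simplex_def)
        moreover have "0 \<le> (\<Sum>j\<in>I. real (k j) / n j)" using assms(3) by (intro sum_nonneg) (auto intro!: divide_nonneg_pos)
        ultimately show False using False by linarith
      qed
      then show ?thesis by (simp add: trig_L1_def)
    qed
    finally show "trig_L1 I ?S (\<lambda>k. if int m \<le> column_floor I n t d k then cis (real m * x) else 0) \<le> K" .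
  qed
  also have "\<dots> = ennreal (real (N + 1)) * K" by (simp add: ennreal_of_nat_eq_real_of_nat del: of_nat_Suc of_nat_add)
  finally show ?thesis .
qed

text \<open>
  Summing each column as a geometric series leaves two sums over the lower-dimensional simplex,
  divided by \<open>cis x - 1\<close>: one for the tops of the columns, with a floor phase, and one for their bottoms.
  In the bound, \<open>pi / \<bar>x\<bar>\<close> has no logarithm as a factor, because the logarithm in the
  floor modulation bound comes with \<open>\<bar>x\<bar>\<close>.
\<close>

lemma trig_L1_columns_le:
  assumes "finite I" "d \<notin> I" "\<And>j. j \<in> insert d I \<Longrightarrow> 0 < n j"
    and K: "trig_L1 I (lattice_simplex I n t) (\<lambda>_. 1) \<le> ennreal K" "0 \<le> K"
    and N: "1 \<le> N" "\<And>j. j \<in> I \<Longrightarrow> n j \<le> real N"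
    and t: "0 \<le> t" "t \<le> 1" and x: "x \<noteq> 0" "\<bar>x\<bar> \<le> pi"
  shows "trig_L1 I (lattice_simplex (insert d I) n t) (\<lambda>k. cis (real (k d) * x)) \<le>
    ennreal (K * (pi / \<bar>x\<bar> + pi / 2 * (1 + ln (real (floor_denom (card I) N)))))"
proof -
  let ?S = "lattice_simplex I n t"
  define L where "L = ln (real (floor_denom (card I) N))"
  have L: "0 \<le> L" using floor_denom_pos[of "card I" N] by (simp add: L_def Suc_le_eq)
  have nd: "0 < n d" using assms(3) by simp
  have npos: "\<forall>j\<in>insert d I. 0 < n j" using assms(3) by blast
  have fin: "finite ?S" using assms by (intro finite_lattice_simplex) auto
  have ge: "2 / pi * \<bar>x\<bar> \<le> cmod (cis x - 1)" by (rule norm_cis_minus_one_ge[OF x(2)])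
  moreover have pos: "0 < 2 / pi * \<bar>x\<bar>" using x by simp
  ultimately have ne: "cis x \<noteq> 1" by auto
  have kN: "k j \<le> N" if "k \<in> ?S" "j \<in> I" for k j
  proof -
    have "real (k j) \<le> t * n j" using assms that by (intro lattice_simplex_le) auto
    also have "\<dots> \<le> n j" using t assms(3) that(2) by (simp add: mult_left_le_one_le less_imp_le)
    finally show ?thesis using N(2)[OF that(2)] by linarith
  qed
  have "trig_L1 I (lattice_simplex (insert d I) n t) (\<lambda>k. cis (real (k d) * x)) =
    trig_L1 I ?S (\<lambda>k. 1 / (cis x - 1) * (cis x * cis (x * of_int (column_floor I n t d k)) + (- 1) * 1))"
    unfolding trig_L1_lattice_simplex_insert[OF assms(1,2) npos]
  proof (rule trig_L1_cong)
    fix k assume "k \<in> ?S"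
    then have "int 0 \<le> column_floor I n t d k"
      unfolding le_column_floor_iff[where n = n and d = d and I = I, OF nd] by (simp add: lattice_simplex_def)
    then have "cis (real (nat (column_floor I n t d k + 1)) * x) = cis x * cis (x * of_int (column_floor I n t d k))"
      by (simp add: cis_mult algebra_simps)
    then show "(\<Sum>m<nat (column_floor I n t d k + 1). cis (real m * x)) =
      1 / (cis x - 1) * (cis x * cis (x * of_int (column_floor I n t d k)) + (- 1) * 1)"
      unfolding sum_cis_geometric[OF ne] by simp
  qed
  also have "\<dots> \<le> ennreal (1 / cmod (cis x - 1)) *
      (trig_L1 I ?S (\<lambda>k. cis (x * of_int (column_floor I n t d k))) + trig_L1 I ?S (\<lambda>_. 1))"
    unfolding trig_L1_scale norm_divide norm_one
    using trig_L1_add_le[of I ?S "\<lambda>k. cis x * cis (x * of_int (column_floor I n t d k))" "\<lambda>k. (- 1) * 1"]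
    unfolding trig_L1_scale by (intro mult_left_mono) simp_all
  also have "\<dots> \<le> ennreal (1 / cmod (cis x - 1)) * (ennreal (1 + \<bar>x\<bar> * (1 + L)) * ennreal K + ennreal K)"
  proof -
    have "trig_L1 I ?S (\<lambda>k. cis (x * of_int (column_floor I n t d k))) \<le>
        ennreal (1 + \<bar>x\<bar> * (1 + L)) * trig_L1 I ?S (\<lambda>_. 1)"
      unfolding column_floor_def L_def using assms(1) fin N(1) kN x(2) by (rule trig_L1_floor_modulation_le)
    also have "\<dots> \<le> ennreal (1 + \<bar>x\<bar> * (1 + L)) * ennreal K"
      using K(1) by (rule mult_left_mono) simp
    finally show ?thesis using K(1) by (intro mult_left_mono add_mono) auto
  qed
  also have "\<dots> = ennreal (1 / cmod (cis x - 1) * (K * (2 + \<bar>x\<bar> * (1 + L))))"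
    using L K(2) by (simp add: ennreal_mult[symmetric] ennreal_plus[symmetric] algebra_simps del: ennreal_plus)
  also have "\<dots> \<le> ennreal (1 / (2 / pi * \<bar>x\<bar>) * (K * (2 + \<bar>x\<bar> * (1 + L))))"
    using L K(2) ge pos
    by (intro ennreal_leI mult_right_mono divide_left_mono mult_pos_pos order.strict_trans2[OF pos ge]) auto
  also have "1 / (2 / pi * \<bar>x\<bar>) * (K * (2 + \<bar>x\<bar> * (1 + L))) = K * (pi / \<bar>x\<bar> + pi / 2 * (1 + L))"
    using x(1) by (simp add: field_simps)
  finally show ?thesis unfolding L_def .
qed

section \<open>The upper bound\<close>

lemma nn_integral_circle_inverse_abs_le:
  assumes "0 < a"
  shows "(\<integral>\<^sup>+x. ennreal (1 / (a + \<bar>x\<bar>)) \<partial>circle) \<le> ennreal (2 * ln (1 + pi / a))"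
proof -
  have R: "(\<integral>\<^sup>+x. ennreal (1 / (a + \<bar>x\<bar>)) * indicator {0..pi} x \<partial>lborel) = ennreal (ln (a + pi) - ln (a + 0))"
    using assms by (intro nn_integral_FTC_Icc) (auto intro!: derivative_eq_intros)
  have "(\<integral>\<^sup>+x. ennreal (1 / (a + \<bar>x\<bar>)) * indicator {-pi..0} x \<partial>lborel) = ennreal (- ln (a - 0) - (- ln (a - (- pi))))"
    using assms by (intro nn_integral_FTC_Icc) (auto intro!: derivative_eq_intros)
  note L = this
  have ln_eq: "ln (a + pi) - ln a = ln (1 + pi / a)"
  proof -
    have "0 < a + pi" using assms pi_gt_zero by linarith
    then show ?thesis using assms ln_div[of "a + pi" a] by (simp add: add_divide_distrib)
  qed
  have "(\<integral>\<^sup>+x. ennreal (1 / (a + \<bar>x\<bar>)) \<partial>circle) = (\<integral>\<^sup>+x. ennreal (1 / (a + \<bar>x\<bar>)) * indicator {-pi<..pi} x \<partial>lborel)"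
    by (rule nn_integral_circle) simp
  also have "\<dots> \<le> (\<integral>\<^sup>+x. ennreal (1 / (a + \<bar>x\<bar>)) * indicator {-pi..0} x + ennreal (1 / (a + \<bar>x\<bar>)) * indicator {0..pi} x \<partial>lborel)"
    by (intro nn_integral_mono) (auto simp: indicator_def)
  also have "\<dots> = ennreal (ln (1 + pi / a)) + ennreal (ln (1 + pi / a))"
    by (subst nn_integral_add) (auto simp: L R ln_eq)
  also have "\<dots> = ennreal (2 * ln (1 + pi / a))"
    using assms by (simp add: ennreal_plus[symmetric] del: ennreal_plus)
  finally show ?thesis .
qed

text \<open>
  For \<open>\<bar>x\<bar> \<le> 1 / N\<close> the bound by slices is used, for larger \<open>\<bar>x\<bar>\<close> the bound by columns.  Both are at
  most a multiple of \<open>1 / (1 / N + \<bar>x\<bar>)\<close> plus a constant, so that only one integral is needed.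
\<close>

lemma trig_L1_lattice_simplex_step:
  assumes I: "finite I" "d \<notin> I" and n: "\<And>j. j \<in> insert d I \<Longrightarrow> 0 < n j"
    and K: "\<And>t. 0 \<le> t \<Longrightarrow> t \<le> 1 \<Longrightarrow> trig_L1 I (lattice_simplex I n t) (\<lambda>_. 1) \<le> ennreal K" "0 \<le> K"
    and N: "1 \<le> N" "\<And>j. j \<in> insert d I \<Longrightarrow> n j \<le> real N"
    and t: "0 \<le> t" "t \<le> 1"
  shows "trig_L1 (insert d I) (lattice_simplex (insert d I) n t) (\<lambda>_. 1) \<le>
    ennreal (K * (4 * pi * ln (1 + pi * real N) + pi\<^sup>2 * (1 + ln (real (floor_denom (card I) N)))))"
proof -
  define L where "L = ln (real (floor_denom (card I) N))"
  have L: "0 \<le> L" using floor_denom_pos[of "card I" N] by (simp add: L_def Suc_le_eq)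
  let ?f = "\<lambda>x. trig_L1 I (lattice_simplex (insert d I) n t) (\<lambda>k. cis (real (k d) * x))"
  have Npos: "1 \<le> real N" using N(1) by simp
  have bd: "?f x \<le> ennreal (K * (2 * pi)) * ennreal (1 / (1 / real N + \<bar>x\<bar>)) + ennreal (K * (pi / 2 * (1 + L)))"
    if x: "\<bar>x\<bar> \<le> pi" for x
  proof -
    have "?f x \<le> ennreal (K * (2 * pi * (1 / (1 / real N + \<bar>x\<bar>)) + pi / 2 * (1 + L)))"
    proof (cases "\<bar>x\<bar> \<le> 1 / real N")
      case True
      have "?f x \<le> ennreal (real (N + 1)) * ennreal K"
        using N(2)[of d] by (intro trig_L1_slices_le I n K t) auto
      also have "\<dots> = ennreal (K * real (N + 1))" using K(2) by (simp add: ennreal_mult'' mult.commute)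
      also have "\<dots> \<le> ennreal (K * (2 * pi * (1 / (1 / real N + \<bar>x\<bar>)) + pi / 2 * (1 + L)))"
      proof (intro ennreal_leI mult_left_mono K(2))
        have "real N / 2 = 1 / (2 / real N)" by simp
        also have "\<dots> \<le> 1 / (1 / real N + \<bar>x\<bar>)"
          using True Npos by (intro divide_left_mono mult_pos_pos add_pos_nonneg) auto
        finally have "2 * pi * (real N / 2) \<le> 2 * pi * (1 / (1 / real N + \<bar>x\<bar>))"
          by (intro mult_left_mono) auto
        moreover have "2 * real N \<le> pi * real N" using pi_gt3 Npos by (intro mult_right_mono) auto
        moreover have "2 * pi * (real N / 2) = pi * real N" by simp
        ultimately have "real (N + 1) \<le> 2 * pi * (1 / (1 / real N + \<bar>x\<bar>))"
          using Npos unfolding of_nat_add of_nat_1 by linarith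
        moreover have "0 \<le> pi / 2 * (1 + L)" using L by simp
        ultimately show "real (N + 1) \<le> 2 * pi * (1 / (1 / real N + \<bar>x\<bar>)) + pi / 2 * (1 + L)" by linarith
      qed
      finally show ?thesis .
    next
      case False
      then have x0: "0 < \<bar>x\<bar>" "1 / real N \<le> \<bar>x\<bar>" using Npos by (auto intro: less_trans[rotated])
      have "?f x \<le> ennreal (K * (pi / \<bar>x\<bar> + pi / 2 * (1 + L)))"
        unfolding L_def using x x0 by (intro trig_L1_columns_le I n K t N) auto
      also have "\<dots> \<le> ennreal (K * (2 * pi * (1 / (1 / real N + \<bar>x\<bar>)) + pi / 2 * (1 + L)))"
      proof (intro ennreal_leI mult_left_mono add_mono K(2) order_refl)
        have "pi / \<bar>x\<bar> = 2 * pi * (1 / (\<bar>x\<bar> + \<bar>x\<bar>))" by simp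
        also have "\<dots> \<le> 2 * pi * (1 / (1 / real N + \<bar>x\<bar>))"
          using x0 Npos by (intro mult_left_mono divide_left_mono add_mono mult_pos_pos add_pos_pos) auto
        finally show "pi / \<bar>x\<bar> \<le> 2 * pi * (1 / (1 / real N + \<bar>x\<bar>))" .
      qed auto
      finally show ?thesis .
    qed
    also have "\<dots> = ennreal (K * (2 * pi)) * ennreal (1 / (1 / real N + \<bar>x\<bar>)) + ennreal (K * (pi / 2 * (1 + L)))"
      using K(2) L Npos
      by (subst ennreal_mult[symmetric], (simp; fail), (simp; fail), subst ennreal_plus[symmetric]) (auto simp: algebra_simps)
    finally show ?thesis .
  qed
  have "trig_L1 (insert d I) (lattice_simplex (insert d I) n t) (\<lambda>_. 1) = (\<integral>\<^sup>+x. ?f x \<partial>circle)"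
    unfolding trig_L1_insert[OF I] by simp
  also have "\<dots> = (\<integral>\<^sup>+x. ?f x * indicator {-pi<..pi} x \<partial>lborel)"
    by (intro nn_integral_circle trig_L1_measurable) measurable
  also have "\<dots> \<le> (\<integral>\<^sup>+x. (ennreal (K * (2 * pi)) * ennreal (1 / (1 / real N + \<bar>x\<bar>)) + ennreal (K * (pi / 2 * (1 + L)))) * indicator {-pi<..pi} x \<partial>lborel)"
    using bd by (intro nn_integral_mono) (auto simp: indicator_def)
  also have "\<dots> = (\<integral>\<^sup>+x. ennreal (K * (2 * pi)) * ennreal (1 / (1 / real N + \<bar>x\<bar>)) + ennreal (K * (pi / 2 * (1 + L))) \<partial>circle)"
    by (rule nn_integral_circle[symmetric]) measurable
  also have "\<dots> = ennreal (K * (2 * pi)) * (\<integral>\<^sup>+x. ennreal (1 / (1 / real N + \<bar>x\<bar>)) \<partial>circle) + ennreal (K * (pi / 2 * (1 + L))) * ennreal (2 * pi)"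
    by (subst nn_integral_add) (auto simp: nn_integral_cmult emeasure_circle)
  also have "\<dots> \<le> ennreal (K * (2 * pi)) * ennreal (2 * ln (1 + pi / (1 / real N))) + ennreal (K * (pi / 2 * (1 + L))) * ennreal (2 * pi)"
    using Npos by (intro add_mono mult_left_mono nn_integral_circle_inverse_abs_le) auto
  also have "\<dots> = ennreal (K * (4 * pi * ln (1 + pi * real N) + pi\<^sup>2 * (1 + L)))"
    using K(2) L Npos
    by (subst (1 2) ennreal_mult[symmetric], simp_all, subst ennreal_plus[symmetric]) (auto simp: algebra_simps power2_eq_square)
  finally show ?thesis unfolding L_def .
qed

text \<open>
  The induction hypothesis is needed for all levels \<open>t\<close> at once, with the same constant, since the slices
  through one simplex lie at different levels.
\<close>

lemma trig_L1_lattice_simplex_le: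
  "\<exists>C\<ge>0. \<forall>(I :: 'i set) n. finite I \<longrightarrow> card I = m \<longrightarrow> (\<forall>j\<in>I. 1 \<le> n j) \<longrightarrow>
     (\<forall>t. 0 \<le> t \<longrightarrow> t \<le> 1 \<longrightarrow>
       trig_L1 I (lattice_simplex I n t) (\<lambda>_. 1) \<le> ennreal (C * (\<Prod>j\<in>I. ln (n j + 1))))"
proof (induction m)
  case 0
  have "lattice_simplex {} n t = {\<lambda>_. 0}" if "0 \<le> t" for n :: "'i \<Rightarrow> real" and t
    using that by (auto simp: lattice_simplex_def)
  then have base: "trig_L1 {} (lattice_simplex {} n t) (\<lambda>_. 1) \<le> ennreal (1 * (\<Prod>j\<in>{}. ln (n j + 1)))"
    if "0 \<le> t" for n :: "'i \<Rightarrow> real" and t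
    using that by (simp add: trig_L1_empty)
  show ?case
  proof (intro exI[of _ 1] conjI allI impI)
    fix I :: "'i set" and n t
    assume "finite I" "card I = 0" "0 \<le> (t :: real)"
    then have "I = {}" by simp
    then show "trig_L1 I (lattice_simplex I n t) (\<lambda>_. 1) \<le> ennreal (1 * (\<Prod>j\<in>I. ln (n j + 1)))"
      using base[OF \<open>0 \<le> t\<close>] by (simp only:)
  qed simp
next
  case (Suc m)
  from Suc.IH obtain C where C: "0 \<le> C" "\<And>(I :: 'i set) n t. finite I \<Longrightarrow> card I = m \<Longrightarrow> (\<forall>j\<in>I. 1 \<le> n j) \<Longrightarrow> 0 \<le> t \<Longrightarrow> t \<le> 1 \<Longrightarrow>
       trig_L1 I (lattice_simplex I n t) (\<lambda>_. 1) \<le> ennreal (C * (\<Prod>j\<in>I. ln (n j + 1)))"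
    by (elim exE conjE) blast
  obtain E where E: "0 < E" "\<And>N. 1 \<le> N \<Longrightarrow> ln (real (floor_denom m N)) \<le> E * ln (real N + 1)"
    using ln_floor_denom_le[of m] by (elim exE conjE) blast
  define A where "A = 2 * (12 * pi + pi\<^sup>2 * (2 + E))"
  have "trig_L1 J (lattice_simplex J n t) (\<lambda>_. 1) \<le> ennreal (C * A * (\<Prod>j\<in>J. ln (n j + 1)))"
    if J: "finite J" "card J = Suc m" and n: "\<forall>j\<in>J. 1 \<le> n j" and t: "0 \<le> t" "t \<le> 1"
    for J :: "'i set" and n t
  proof -
    (* Splitting off the largest n d bounds all coordinates by N, which keeps ln (floor_denom m N)
       within a constant multiple of ln (n d + 1). *)
    have "J \<noteq> {}" using J by auto
    then obtain d where d: "d \<in> J" "\<And>j. j \<in> J \<Longrightarrow> n j \<le> n d"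
    proof -
      have "Max (n ` J) \<in> n ` J" using J(1) \<open>J \<noteq> {}\<close> by (intro Max_in) auto
      then obtain d where "d \<in> J" "Max (n ` J) = n d" by auto
      then show thesis using that[of d] J(1) by (metis Max_ge finite_imageI imageI)
    qed
    define I where "I = J - {d}"
    have I: "finite I" "d \<notin> I" "card I = m" "insert d I = J"
      using J d by (auto simp: I_def)
    define K where "K = C * (\<Prod>j\<in>I. ln (n j + 1))"
    have nd: "1 \<le> n d" using n d by simp
    define N where "N = nat \<lceil>n d\<rceil>"
    have N: "1 \<le> N" "n d \<le> real N" "real N \<le> n d + 1"
      using nd unfolding N_def by linarith+
    have nN: "n j \<le> real N" if "j \<in> insert d I" for j using d(2)[of j] N(2) I(4) that by auto
    have K0: "0 \<le> K"
      unfolding K_def using C(1) n I by (intro mult_nonneg_nonneg prod_nonneg) (auto simp: I_def)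
    have Kb: "trig_L1 I (lattice_simplex I n s) (\<lambda>_. 1) \<le> ennreal K" if "0 \<le> s" "s \<le> 1" for s
      unfolding K_def using n I that by (intro C(2)) auto
    have np: "0 < n j" if "j \<in> insert d I" for j
      using n that I(4) by (smt (verit))
    have l1: "1 \<le> 2 * ln (real N + 1)"
    proof -
      have "ln 2 \<le> ln (real N + 1)" using N(1) by simp
      then show ?thesis using ln2_ge_two_thirds by linarith
    qed
    have l2: "ln (1 + pi * real N) \<le> 3 * ln (real N + 1)"
    proof -
      have "1 + pi * real N \<le> 2 ^ 2 * (real N + 1)"
        using pi_less_4 mult_right_mono[of pi 4 "real N"] by simp
      also have "\<dots> \<le> (real N + 1) ^ 2 * (real N + 1)"
        using N(1) by (intro mult_right_mono power_mono) auto
      also have "\<dots> = (real N + 1) ^ 3" by (simp add: power2_eq_square power3_eq_cube)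
      finally have "ln (1 + pi * real N) \<le> ln ((real N + 1) ^ 3)"
        by (subst ln_le_cancel_iff) (auto intro: add_pos_nonneg)
      then show ?thesis by (simp add: ln_realpow)
    qed
    have l3: "ln (real N + 1) \<le> 2 * ln (n d + 1)"
    proof -
      have "n d * 1 \<le> n d * n d" using nd by (intro mult_left_mono) auto
      then have "real N + 1 \<le> (n d + 1)\<^sup>2"
        unfolding power2_eq_square using N(3) nd by (simp only: distrib_left distrib_right mult_1_right mult_1_left)
      then have "ln (real N + 1) \<le> ln ((n d + 1)\<^sup>2)" using nd by (subst ln_le_cancel_iff) auto
      then show ?thesis using nd by (simp add: ln_realpow)
    qed
    have "trig_L1 J (lattice_simplex J n t) (\<lambda>_. 1) \<le>
      ennreal (K * (4 * pi * ln (1 + pi * real N) + pi\<^sup>2 * (1 + ln (real (floor_denom (card I) N)))))"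
      unfolding I(4)[symmetric]
      by (rule trig_L1_lattice_simplex_step[OF I(1,2) np Kb K0 N(1) nN t])
    also have "\<dots> \<le> ennreal (K * (4 * pi * (3 * ln (real N + 1)) + pi\<^sup>2 * (2 * ln (real N + 1) + E * ln (real N + 1))))"
      using l1 l2 E(2)[OF N(1)] unfolding I(3)
      by (intro ennreal_leI mult_left_mono add_mono K0) auto
    also have "\<dots> = ennreal (K * ((12 * pi + pi\<^sup>2 * (2 + E)) * ln (real N + 1)))"
      by (simp add: algebra_simps)
    also have "\<dots> \<le> ennreal (K * ((12 * pi + pi\<^sup>2 * (2 + E)) * (2 * ln (n d + 1))))"
      using l3 E(1) by (intro ennreal_leI mult_left_mono K0) auto
    also have "K * ((12 * pi + pi\<^sup>2 * (2 + E)) * (2 * ln (n d + 1))) = C * A * (ln (n d + 1) * (\<Prod>j\<in>I. ln (n j + 1)))"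
      by (simp add: A_def K_def)
    also have "ln (n d + 1) * (\<Prod>j\<in>I. ln (n j + 1)) = (\<Prod>j\<in>J. ln (n j + 1))"
      unfolding I(4)[symmetric] using I(1,2) by simp
    finally show ?thesis .
  qed
  moreover have "0 \<le> C * A" using C(1) E(1) by (simp add: A_def)
  ultimately show ?case by blast
qed

section \<open>The lower bound\<close>

text \<open>
  Up to a constant factor, the sawtooth with jump at \<open>0\<close> times \<open>cis t\<close>.  The Fourier coefficients of
  the sawtooth are proportional to \<open>1 / m\<close>, and the factor \<open>cis t\<close> shifts \<open>m\<close> to \<open>k + 1\<close>.
\<close>

definition hardy_kernel :: "real \<Rightarrow> complex" where
  "hardy_kernel t =
     (if - pi < t \<and> t \<le> 0 then \<i> * of_real ((pi + t) / pi) * cis t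
      else if 0 < t \<and> t \<le> pi then - \<i> * of_real ((pi - t) / pi) * cis t else 0)"

lemma hardy_kernel_measurable [measurable]: "hardy_kernel \<in> borel_measurable borel"
  unfolding hardy_kernel_def[abs_def] by measurable

lemma norm_hardy_kernel_le: "cmod (hardy_kernel t) \<le> 1"
  by (auto simp: hardy_kernel_def norm_mult simp del: of_real_divide of_real_add of_real_diff)

lemma has_vector_derivative_cis_mult:
  "((\<lambda>t. cis (a * t)) has_vector_derivative (\<i> * of_real a * cis (a * t))) (at t within A)"
proof -
  have "((\<lambda>t. exp (\<i> * of_real a * of_real t)) has_vector_derivative (\<i> * of_real a * exp (\<i> * of_real a * of_real t))) (at t within A)"
    by (auto intro!: derivative_eq_intros has_vector_derivative_real_field simp: mult_ac)
  then show ?thesis by (simp add: cis_conv_exp mult_ac)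
qed

lemma integral_hardy_kernel:
  "(\<integral>t. cis (real k * t) * hardy_kernel t \<partial>circle) = of_real (2 / (real k + 1))"
proof -
  define m where "m = real k + 1"
  have m: "m \<noteq> 0" "complex_of_real m \<noteq> 0" by (auto simp: m_def complex_of_real_def complex_eq_iff)
  define A where "A t = \<i> * of_real ((pi + t) / pi) * cis (m * t)" for t
  define B where "B t = - \<i> * of_real ((pi - t) / pi) * cis (m * t)" for t
  define FA where "FA t = (of_real (pi + t) / of_real (pi * m) - 1 / (\<i> * of_real (pi * m\<^sup>2))) * cis (m * t)" for t
  define FB where "FB t = (- of_real (pi - t) / of_real (pi * m) - 1 / (\<i> * of_real (pi * m\<^sup>2))) * cis (m * t)" for t
  have "(FA has_vector_derivative A t) (at t within X)" for t X
    unfolding FA_def A_def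
    by (rule derivative_eq_intros has_vector_derivative_cis_mult refl | simp)+
       (use m in \<open>simp add: field_simps power2_eq_square\<close>)
  then have IA: "has_bochner_integral lborel (\<lambda>t. indicator {- pi..0} t *\<^sub>R A t) (FA 0 - FA (- pi))"
    by (intro has_bochner_integral_FTC_Icc) (auto simp: A_def intro!: continuous_intros)
  have "(FB has_vector_derivative B t) (at t within X)" for t X
    unfolding FB_def B_def
    by (rule derivative_eq_intros has_vector_derivative_cis_mult refl | simp)+
       (use m in \<open>simp add: field_simps power2_eq_square\<close>)
  then have IB: "has_bochner_integral lborel (\<lambda>t. indicator {0..pi} t *\<^sub>R B t) (FB pi - FB 0)"
    by (intro has_bochner_integral_FTC_Icc) (auto simp: B_def intro!: continuous_intros)
  have per: "cis (m * pi) = cis (- (m * pi))"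
  proof -
    have "cis (m * pi) = cis (- (m * pi)) * cis (2 * pi * m)" by (simp add: cis_mult mult.commute)
    also have "cis (2 * pi * m) = 1" by (rule cis_multiple_2pi) (auto simp: m_def)
    finally show ?thesis by simp
  qed
  have val: "(FA 0 - FA (- pi)) + (FB pi - FB 0) = of_real (2 / m)"
    using m per by (simp add: FA_def FB_def field_simps)
  have "(\<integral>t. cis (real k * t) * hardy_kernel t \<partial>circle) =
      (\<integral>t. indicator {-pi<..pi} t *\<^sub>R (cis (real k * t) * hardy_kernel t) \<partial>lborel)"
    unfolding circle_def ennreal_indicator[symmetric] by (rule integral_density) (auto simp: indicator_def)
  also have "\<dots> = (\<integral>t. indicator {- pi..0} t *\<^sub>R A t + indicator {0..pi} t *\<^sub>R B t \<partial>lborel)"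
  proof (rule integral_cong_AE)
    have "AE t in lborel. t \<noteq> 0" "AE t in lborel. t \<noteq> - pi" by (rule AE_lborel_singleton)+
    then show "AE t in lborel. indicator {-pi<..pi} t *\<^sub>R (cis (real k * t) * hardy_kernel t) =
       indicator {- pi..0} t *\<^sub>R A t + indicator {0..pi} t *\<^sub>R B t"
    proof eventually_elim
      case (elim t)
      have "cis (m * t) = cis (real k * t) * cis t" by (simp add: cis_mult m_def algebra_simps)
      then show ?case using elim
        by (auto simp: indicator_def hardy_kernel_def A_def B_def mult_ac)
    qed
  qed (auto simp: A_def B_def)
  also have "\<dots> = of_real (2 / m)"
    using has_bochner_integral_add[OF IA IB] unfolding val by (rule has_bochner_integral_integral_eq)
  finally show ?thesis by (simp add: m_def)
qed

lemma integrable_circle_cis_hardy_kernel: "integrable circle (\<lambda>t. cis (real k * t) * hardy_kernel t)"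
  by (rule circle.integrable_const_bound[where B = 1]) (auto simp: norm_mult norm_hardy_kernel_le)

text \<open>
  The sum is tested against the product of the kernels in all variables, which has modulus at most \<open>1\<close>.
\<close>

lemma trig_L1_ge_hardy_sum:
  assumes "finite I" "finite S"
  shows "ennreal (\<Sum>k\<in>S. \<Prod>j\<in>I. 2 / (real (k j) + 1)) \<le> trig_L1 I S (\<lambda>_. 1)"
proof -
  define G where "G k x = (\<Prod>j\<in>I. cis (real (k j) * x j) * hardy_kernel (x j))" for k :: "'a \<Rightarrow> nat" and x
  have int: "integrable (PiM I (\<lambda>_. circle)) (G k)" for k
    unfolding G_def using assms(1) integrable_circle_cis_hardy_kernel
    by (intro circles.product_integrable_prod)
  have val: "(\<integral>x. G k x \<partial>PiM I (\<lambda>_. circle)) = of_real (\<Prod>j\<in>I. 2 / (real (k j) + 1))" for k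
    unfolding G_def
    by (subst circles.product_integral_prod[where f = "\<lambda>j t. cis (real (k j) * t) * hardy_kernel t"])
       (simp_all add: assms(1) integrable_circle_cis_hardy_kernel integral_hardy_kernel)
  have cis_prod: "cis (\<Sum>j\<in>I. f j) = (\<Prod>j\<in>I. cis (f j))" for f
    using assms(1) by (induction I rule: finite_induct) (simp_all add: cis_mult[symmetric])
  have G: "(\<Sum>k\<in>S. G k x) = (\<Sum>k\<in>S. 1 * cis (\<Sum>j\<in>I. real (k j) * x j)) * (\<Prod>j\<in>I. hardy_kernel (x j))" for x
    by (simp add: G_def cis_prod prod.distrib sum_distrib_right)
  have "(\<integral>x. (\<Sum>k\<in>S. G k x) \<partial>PiM I (\<lambda>_. circle)) = of_real (\<Sum>k\<in>S. \<Prod>j\<in>I. 2 / (real (k j) + 1))"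
    by (simp add: Bochner_Integration.integral_sum int val)
  moreover have "0 \<le> (\<Sum>k\<in>S. \<Prod>j\<in>I. 2 / (real (k j) + 1))"
    by (intro sum_nonneg prod_nonneg) auto
  ultimately have "ennreal (\<Sum>k\<in>S. \<Prod>j\<in>I. 2 / (real (k j) + 1)) =
      ennreal (cmod (\<integral>x. (\<Sum>k\<in>S. G k x) \<partial>PiM I (\<lambda>_. circle)))"
    by (simp only: norm_of_real abs_of_nonneg)
  also have "\<dots> \<le> (\<integral>\<^sup>+x. ennreal (cmod (\<Sum>k\<in>S. G k x)) \<partial>PiM I (\<lambda>_. circle))"
    by (intro integral_norm_bound_ennreal Bochner_Integration.integrable_sum int)
  also have "\<dots> \<le> trig_L1 I S (\<lambda>_. 1)"
    unfolding trig_L1_def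
  proof (intro nn_integral_mono ennreal_leI)
    fix x
    have "cmod (\<Prod>j\<in>I. hardy_kernel (x j)) \<le> 1"
      unfolding prod_norm[symmetric] by (intro prod_le_1) (auto simp: norm_hardy_kernel_le)
    then show "cmod (\<Sum>k\<in>S. G k x) \<le> cmod (\<Sum>k\<in>S. 1 * cis (\<Sum>j\<in>I. real (k j) * x j))"
      unfolding G norm_mult by (rule mult_right_le_one_le[OF norm_ge_zero norm_ge_zero])
  qed
  finally show ?thesis .
qed

text \<open>
  With \<open>d\<close> the dimension, the simplex contains the box \<open>k j \<le> n j / d\<close>.  Passing from
  \<open>ln (1 + n j / d)\<close> to \<open>ln (1 + n j)\<close> costs the factor \<open>d\<close>, by Bernoulli's inequality.
\<close>

lemma hardy_sum_lattice_simplex_ge: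
  fixes n :: "'i::finite \<Rightarrow> real"
  assumes n: "\<And>j. 1 \<le> n j"
  shows "(\<Prod>j\<in>UNIV. 2 / real CARD('i) * ln (n j + 1)) \<le>
    (\<Sum>k\<in>lattice_simplex UNIV n 1. \<Prod>j\<in>UNIV. 2 / (real (k j) + 1))"
proof -
  define d where "d = CARD('i)"
  have d: "0 < d" by (simp add: d_def)
  define b where "b j = nat \<lfloor>n j / real d\<rfloor>" for j
  have n0: "0 < n j" "0 \<le> n j" for j using n[of j] by linarith+
  have b: "real (b j) \<le> n j / real d" "n j / real d < real (b j) + 1" for j
  proof -
    have "0 \<le> n j / real d" using n0[of j] by simp
    then show "real (b j) \<le> n j / real d" "n j / real d < real (b j) + 1"
      unfolding b_def by linarith+
  qed
  have "2 / real d * ln (n j + 1) \<le> (\<Sum>m\<le>b j. 2 / (real m + 1))" for j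
  proof -
    have "1 + real d * (n j / real d) \<le> (1 + n j / real d) ^ d"
      using n0[of j] by (intro Bernoulli_inequality) (smt (verit) divide_nonneg_nonneg of_nat_0_le_iff)
    then have "ln (n j + 1) \<le> ln ((1 + n j / real d) ^ d)"
      using n0[of j] d by (subst ln_le_cancel_iff) (auto intro!: add_pos_nonneg simp: add.commute)
    also have "\<dots> = real d * ln (1 + n j / real d)"
      using n0[of j] by (intro ln_realpow)
    also have "ln (1 + n j / real d) \<le> ln (real (Suc (b j)) + 1)"
      using n0[of j] b[of j] by (subst ln_le_cancel_iff) (auto intro!: add_pos_nonneg)
    also have "\<dots> \<le> harm (Suc (b j))" by (rule ln_le_harm)
    finally have "ln (n j + 1) \<le> real d * harm (Suc (b j))" using d by simp
    then have "2 / real d * ln (n j + 1) \<le> 2 * harm (Suc (b j))" using d by (simp add: field_simps)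
    also have "harm (Suc (b j)) = (\<Sum>m\<le>b j. 1 / (real m + 1))"
      unfolding harm_def
      by (rule sum.reindex_bij_witness[where i = Suc and j = "\<lambda>m. m - 1"]) (auto simp: field_simps)
    finally show ?thesis by (simp add: sum_distrib_left)
  qed
  then have "(\<Prod>j\<in>UNIV. 2 / real d * ln (n j + 1)) \<le> (\<Prod>j\<in>UNIV. \<Sum>m\<le>b j. 2 / (real m + 1))"
    using n0 by (intro prod_mono) auto
  also have "\<dots> = (\<Sum>k\<in>PiE UNIV (\<lambda>j. {..b j}). \<Prod>j\<in>UNIV. 2 / (real (k j) + 1))"
    by (rule prod_sum_PiE) auto
  also have "\<dots> \<le> (\<Sum>k\<in>lattice_simplex UNIV n 1. \<Prod>j\<in>UNIV. 2 / (real (k j) + 1))"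
  proof (rule sum_mono2)
    show "finite (lattice_simplex UNIV n 1)" using n0 by (intro finite_lattice_simplex) auto
    show "PiE UNIV (\<lambda>j. {..b j}) \<subseteq> lattice_simplex UNIV n 1"
    proof
      fix k assume k: "k \<in> PiE UNIV (\<lambda>j. {..b j})"
      have "(\<Sum>j\<in>UNIV. real (k j) / n j) \<le> (\<Sum>j\<in>(UNIV :: 'i set). 1 / real d)"
      proof (rule sum_mono)
        fix j
        have "real (k j) \<le> n j / real d" using k b(1)[of j] by (auto simp: PiE_def Pi_def intro: order_trans[rotated])
        then show "real (k j) / n j \<le> 1 / real d" using n0[of j] d by (simp add: field_simps)
      qed
      also have "\<dots> = 1" using d by (simp add: d_def)
      finally show "k \<in> lattice_simplex UNIV n 1" by (simp add: lattice_simplex_def)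
    qed
  qed (auto intro!: prod_nonneg)
  finally show ?thesis unfolding d_def .
qed

section \<open>Lebesgue constants of simplices\<close>

lemma PiM_circle_eq_density:
  assumes "finite I"
  shows "PiM I (\<lambda>_. circle) = density (PiM I (\<lambda>_. lborel)) (\<lambda>x. \<Prod>j\<in>I. indicator {-pi<..pi} (x j))"
proof -
  interpret L: product_sigma_finite "\<lambda>_ :: 'a. lborel :: real measure" by standard
  show ?thesis
  proof (rule circles.PiM_eqI[OF assms, symmetric])
    show "sets (density (PiM I (\<lambda>_. lborel)) (\<lambda>x. \<Prod>j\<in>I. indicator {-pi<..pi} (x j))) = sets (PiM I (\<lambda>_. circle))"
      by (simp cong: sets_PiM_cong)
    fix A assume A: "\<And>i. i \<in> I \<Longrightarrow> A i \<in> sets circle"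
    then have A': "\<And>i. i \<in> I \<Longrightarrow> A i \<in> sets borel" by simp
    have PA: "PiE I A \<in> sets (PiM I (\<lambda>_. lborel))"
      using assms A' by (intro sets_PiM_I_finite) auto
    have "emeasure (density (PiM I (\<lambda>_. lborel)) (\<lambda>x. \<Prod>j\<in>I. indicator {-pi<..pi} (x j))) (PiE I A) =
      (\<integral>\<^sup>+x. (\<Prod>j\<in>I. indicator {-pi<..pi} (x j)) * indicator (PiE I A) x \<partial>PiM I (\<lambda>_. lborel))"
      by (rule emeasure_density) (use PA in measurable)
    also have "\<dots> = (\<integral>\<^sup>+x. (\<Prod>j\<in>I. indicator {-pi<..pi} (x j) * indicator (A j) (x j)) \<partial>PiM I (\<lambda>_. lborel))"
    proof (rule nn_integral_cong)
      fix x :: "'a \<Rightarrow> real" assume "x \<in> space (PiM I (\<lambda>_. lborel))"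
      then have "(indicator (PiE I A) x :: ennreal) = (\<Prod>j\<in>I. indicator (A j) (x j))"
        using assms by (auto simp: space_PiM indicator_def PiE_iff prod_zero_iff)
      then show "(\<Prod>j\<in>I. indicator {-pi<..pi} (x j)) * indicator (PiE I A) x =
        (\<Prod>j\<in>I. indicator {-pi<..pi} (x j) * indicator (A j) (x j) :: ennreal)"
        by (simp add: prod.distrib)
    qed
    also have "\<dots> = (\<Prod>j\<in>I. \<integral>\<^sup>+t. indicator {-pi<..pi} t * indicator (A j) t \<partial>lborel)"
      using assms A' by (intro L.product_nn_integral_prod) (auto intro!: borel_measurable_times borel_measurable_indicator)
    also have "\<dots> = (\<Prod>j\<in>I. emeasure circle (A j))"
      using A' by (intro prod.cong refl) (simp add: circle_def emeasure_density)
    finally show "emeasure (density (PiM I (\<lambda>_. lborel)) (\<lambda>x. \<Prod>j\<in>I. indicator {-pi<..pi} (x j))) (PiE I A) =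
      (\<Prod>j\<in>I. emeasure circle (A j))" .
  qed
qed

lemma vec_lambda_measurable [measurable]:
  "vec_lambda \<in> borel_measurable (PiM UNIV (\<lambda>_ :: 'd::finite. lborel :: real measure))"
  unfolding borel_measurable_euclidean_space[of "vec_lambda :: ('d \<Rightarrow> real) \<Rightarrow> real ^ 'd"]
  by (auto simp: Basis_vec_def inner_axis)

lemma lborel_vec_eq_distr_PiM:
  "(lborel :: (real ^ 'd::finite) measure) = distr (PiM UNIV (\<lambda>_. lborel)) borel vec_lambda"
proof (rule lborel_eqI)
  interpret L: finite_product_sigma_finite "\<lambda>_ :: 'd. lborel :: real measure" UNIV by standard simp
  fix l u :: "real ^ 'd" assume le: "\<And>b. b \<in> Basis \<Longrightarrow> l \<bullet> b \<le> u \<bullet> b"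
  have le': "l $ j \<le> u $ j" for j using le[of "axis j 1"] by (simp add: inner_axis axis_in_Basis_iff)
  have "vec_lambda -` box l u \<inter> space (PiM UNIV (\<lambda>_ :: 'd. lborel :: real measure)) = PiE UNIV (\<lambda>j. {l $ j<..<u $ j})"
    by (auto simp: space_PiM mem_box_cart PiE_iff)
  then have "emeasure (distr (PiM UNIV (\<lambda>_. lborel)) borel vec_lambda) (box l u) =
      emeasure (PiM UNIV (\<lambda>_ :: 'd. lborel)) (PiE UNIV (\<lambda>j. {l $ j<..<u $ j}))"
    by (subst emeasure_distr) auto
  also have "\<dots> = (\<Prod>j\<in>UNIV. ennreal (u $ j - l $ j))"
    using le' by (subst L.measure_times) auto
  also have "\<dots> = ennreal (\<Prod>j\<in>UNIV. u $ j - l $ j)"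
    using le' by (intro prod_ennreal) auto
  also have "(\<Prod>j\<in>UNIV. u $ j - l $ j) = (\<Prod>b\<in>Basis. (u - l) \<bullet> b)"
  proof -
    have B: "(Basis :: (real ^ 'd) set) = (\<lambda>j. axis j 1) ` UNIV" by (auto simp: Basis_vec_def)
    have "inj (\<lambda>j :: 'd. axis j (1 :: real))" by (auto simp: inj_on_def axis_eq_axis)
    then show ?thesis unfolding B by (subst prod.reindex) (auto simp: inner_axis)
  qed
  finally show "emeasure (distr (PiM UNIV (\<lambda>_. lborel)) borel vec_lambda) (box l u) = ennreal (\<Prod>b\<in>Basis. (u - l) \<bullet> b)" .
qed simp

lemma lebesgue_constant_simplex_eq:
  fixes n :: "real ^ 'd::finite"
  assumes "\<forall>j. 1 \<le> n $ j"
  shows "lebesgue_constant (simplex_region n) =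
    1 / (2 * pi) ^ CARD('d) * enn2real (trig_L1 UNIV (lattice_simplex UNIV (($) n) 1) (\<lambda>_. 1))"
proof -
  let ?S = "lattice_simplex UNIV (($) n) 1"
  define D where "D x = cmod (\<Sum>k\<in>?S. cis (\<Sum>j\<in>UNIV. real (k j) * x j))" for x :: "'d \<Rightarrow> real"
  define v where "v k = (\<chi> j. real (k j))" for k :: "'d \<Rightarrow> nat"
  have inj: "inj_on v ?S" by (auto simp: inj_on_def v_def vec_eq_iff)
  have img: "simplex_region n \<inter> integer_lattice = v ` ?S"
  proof (intro equalityI subsetI)
    fix \<xi> assume x: "\<xi> \<in> simplex_region n \<inter> integer_lattice"
    then have nn: "0 \<le> \<xi> $ j" "\<xi> $ j \<in> \<int>" for j by (auto simp: simplex_region_def integer_lattice_def)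
    define k where "k j = nat \<lfloor>\<xi> $ j\<rfloor>" for j
    have k: "real (k j) = \<xi> $ j" for j
      using nn[of j] by (auto simp: k_def elim!: Ints_cases)
    then have "\<xi> = v k" by (simp add: v_def vec_eq_iff)
    moreover have "k \<in> ?S" using x by (simp add: lattice_simplex_def k simplex_region_def)
    ultimately show "\<xi> \<in> v ` ?S" by blast
  qed (auto simp: v_def simplex_region_def integer_lattice_def lattice_simplex_def)
  have D: "cmod (\<Sum>k\<in>simplex_region n \<inter> integer_lattice. exp (\<i> * complex_of_real (k \<bullet> x))) = D (($) x)" for x
    unfolding img sum.reindex[OF inj] D_def by (simp add: v_def inner_vec_def cis_conv_exp)
  have Dm [measurable]: "D \<in> borel_measurable (PiM UNIV (\<lambda>_. lborel))"
    unfolding D_def by measurable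
  have Dm' [measurable]: "(\<lambda>x :: real ^ 'd. D (($) x)) \<in> borel_measurable borel"
    unfolding D_def by measurable
  have torus: "torus = (\<Inter>j. {x :: real ^ 'd. x $ j \<in> {-pi<..pi}})" by (auto simp: torus_def)
  have [measurable]: "(torus :: (real ^ 'd) set) \<in> sets borel"
    unfolding torus by measurable
  have "(LINT x:torus|lborel. D (($) x)) = enn2real (\<integral>\<^sup>+x. ennreal (indicator torus x * D (($) x)) \<partial>lborel)"
    unfolding set_lebesgue_integral_def
    by (subst integral_eq_nn_integral) (auto simp: D_def)
  also have "(\<integral>\<^sup>+x. ennreal (indicator torus x * D (($) x)) \<partial>lborel) =
      (\<integral>\<^sup>+x. ennreal (indicator torus (vec_lambda x) * D x) \<partial>PiM UNIV (\<lambda>_. lborel))"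
  proof -
    have "($) (vec_lambda x) = x" for x :: "'d \<Rightarrow> real" by (rule ext) simp
    then show ?thesis by (subst lborel_vec_eq_distr_PiM) (simp add: nn_integral_distr)
  qed
  also have "\<dots> = (\<integral>\<^sup>+x. (\<Prod>j\<in>UNIV. indicator {-pi<..pi} (x j)) * ennreal (D x) \<partial>PiM UNIV (\<lambda>_. lborel))"
  proof (rule nn_integral_cong)
    fix x :: "'d \<Rightarrow> real"
    have "ennreal (indicator torus (vec_lambda x)) = (\<Prod>j\<in>UNIV. indicator {-pi<..pi} (x j))"
      by (auto simp: indicator_def torus_def)
    then show "ennreal (indicator torus (vec_lambda x) * D x) = (\<Prod>j\<in>UNIV. indicator {-pi<..pi} (x j)) * ennreal (D x)"
      by (simp add: ennreal_mult' D_def)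
  qed
  also have "\<dots> = trig_L1 UNIV ?S (\<lambda>_. 1)"
    unfolding trig_L1_def PiM_circle_eq_density[OF finite]
    by (subst nn_integral_density) (auto simp: D_def)
  finally show ?thesis unfolding lebesgue_constant_def D by simp
qed

theorem corollary4p1:
  "\<exists>c C :: real. 0 < c \<and> 0 < C \<and>
     (\<forall>n :: real ^ 'd::finite. (\<forall>j. 1 \<le> n $ j) \<longrightarrow>
        c * (\<Prod>j\<in>UNIV. ln (n $ j + 1)) \<le> lebesgue_constant (simplex_region n) \<and>
        lebesgue_constant (simplex_region n) \<le> C * (\<Prod>j\<in>UNIV. ln (n $ j + 1)))"
proof -
  let ?d = "CARD('d)"
  obtain B where B: "0 \<le> B" "\<And>n :: 'd \<Rightarrow> real. (\<forall>j. 1 \<le> n j) \<Longrightarrow>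
      trig_L1 UNIV (lattice_simplex UNIV n 1) (\<lambda>_. 1) \<le> ennreal (B * (\<Prod>j\<in>UNIV. ln (n j + 1)))"
    using trig_L1_lattice_simplex_le[of ?d, where 'i = 'd] by fastforce
  define w where "w = 1 / (2 * pi) ^ ?d"
  have w: "0 < w" by (simp add: w_def)
  define c where "c = w * (2 / real ?d) ^ ?d"
  have c: "0 < c" using w by (simp add: c_def)
  have "c * (\<Prod>j\<in>UNIV. ln (n $ j + 1)) \<le> lebesgue_constant (simplex_region n) \<and>
        lebesgue_constant (simplex_region n) \<le> (w * (B + 1)) * (\<Prod>j\<in>UNIV. ln (n $ j + 1))"
    if n: "\<forall>j. 1 \<le> n $ j" for n :: "real ^ 'd"
  proof -
    let ?S = "lattice_simplex UNIV (($) n) 1"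
    define T where "T = trig_L1 UNIV ?S (\<lambda>_. 1)"
    define P where "P = (\<Prod>j\<in>UNIV. ln (n $ j + 1))"
    have n0: "0 < n $ j" for j using n by (smt (verit))
    have P: "0 \<le> P" unfolding P_def using n0 by (intro prod_nonneg) (simp add: less_imp_le)
    have fin: "finite ?S" using n0 by (intro finite_lattice_simplex) auto
    have up: "T \<le> ennreal (B * P)" unfolding T_def P_def by (rule B(2)[OF n])
    then have T: "ennreal (enn2real T) = T" by (intro ennreal_enn2real le_less_trans[OF _ ennreal_less_top])
    have "(2 / real ?d) ^ ?d * P = (\<Prod>j\<in>UNIV. 2 / real ?d * ln (n $ j + 1))"
      by (simp add: P_def prod.distrib del: times_divide_eq_left)
    also have "\<dots> \<le> (\<Sum>k\<in>?S. \<Prod>j\<in>UNIV. 2 / (real (k j) + 1))"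
      using n by (intro hardy_sum_lattice_simplex_ge) auto
    finally have "ennreal ((2 / real ?d) ^ ?d * P) \<le> ennreal (\<Sum>k\<in>?S. \<Prod>j\<in>UNIV. 2 / (real (k j) + 1))"
      by (rule ennreal_leI)
    also have "\<dots> \<le> T"
      unfolding T_def by (intro trig_L1_ge_hardy_sum fin) simp
    finally have lo: "(2 / real ?d) ^ ?d * P \<le> enn2real T"
      using T by (metis enn2real_nonneg ennreal_le_iff)
    have "enn2real T \<le> B * P" using up P B(1) by (intro enn2real_leI) auto
    also have "\<dots> \<le> (B + 1) * P" using P by (simp add: distrib_right)
    finally have "w * enn2real T \<le> w * ((B + 1) * P)" using w by (intro mult_left_mono) auto
    moreover have "w * ((2 / real ?d) ^ ?d * P) \<le> w * enn2real T" using lo w by (intro mult_left_mono) auto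
    moreover have "lebesgue_constant (simplex_region n) = w * enn2real T"
      unfolding w_def T_def by (rule lebesgue_constant_simplex_eq[OF n])
    ultimately show ?thesis unfolding P_def[symmetric] c_def by (simp only: mult.assoc)
  qed
  (* B + 1, because B may vanish while the constant must be positive. *)
  moreover have "0 < w * (B + 1)" using w B(1) by simp
  ultimately show ?thesis using c by blast
qed

end
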